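(* Let $a\ge5$ be an integer with $a=2\ell+1$, where $\ell\ge2$ is an integer. Let $k$ be a field, $A=k[[t^a,t^{a+1}]]\subseteq k[[t]]$, and $\mathfrak m=(t^a,t^{a+1})$ the maximal ideal of $A$. Let $0\le r\le\ell$ be an integer and put $s=a\ell+r$. Then $\mathrm G(I)$ is a Cohen-Macaulay ring if and only if either $r=0$ or $r=\ell$, where $I=(t^s):\mathfrak m^{a-1}$.
   Context: $k[[t]]$ is the formal power series ring in an indeterminate $t$; $(t^s):\mathfrak m^{a-1}=\{x\in A\mid\mathfrak m^{a-1}x\subseteq t^sA\}$ (note $t^s\in A$ since $r\le\ell$). $\mathrm G(I)=\bigoplus_{n\ge0}I^n/I^{n+1}$ is the associated graded ring. *)

theory Defs
  imports "HOL-Algebra.Algebra" "HOL-Computational_Algebra.Formal_Power_Series"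
    "HOL-Library.Extended_Nat"
begin

text \<open>
  The carrier is the image of the substitution homomorphism $k[[X,Y]] \to k[[t]]$ with
  $X \mapsto t^a$ and $Y \mapsto t^b$: the power series
  $\sum_{i,j} c_{ij} X^i Y^j$ is sent to $\sum_{i,j} c_{ij} t^{ai+bj}$. For $a, b > 0$ (the only case
  of interest) the coefficient sums below are finite.
\<close>

definition fps_subring2 :: "nat \<Rightarrow> nat \<Rightarrow> 'k::field fps ring" where
  "fps_subring2 a b =
     \<lparr>carrier = {Abs_fps (\<lambda>n. \<Sum>(i, j) \<in> {(i, j). a * i + b * j = n}. c i j) |
                   c :: nat \<Rightarrow> nat \<Rightarrow> 'k. True},
      monoid.mult = (*), one = 1, ring.zero = 0, add = (+)\<rparr>"

primrec ideal_pow :: "('a, 'b) ring_scheme \<Rightarrow> 'a set \<Rightarrow> nat \<Rightarrow> 'a set" where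
  "ideal_pow R I 0 = carrier R"
| "ideal_pow R I (Suc n) = ideal_prod R (ideal_pow R I n) I"

definition ideal_colon :: "('a, 'b) ring_scheme \<Rightarrow> 'a set \<Rightarrow> 'a set \<Rightarrow> 'a set" where
  "ideal_colon R J K = {x \<in> carrier R. \<forall>y\<in>K. y \<otimes>\<^bsub>R\<^esub> x \<in> J}"

text \<open>
  An element of $\bigoplus_n I^n/I^{n+1}$ is a function $g$ on the naturals whose value $g(n)$ is a
  coset of $I^{n+1}$ with a representative in $I^n$, equal to the zero coset $I^{n+1}$ for all but
  finitely many $n$. The product is $(gh)_n = \sum_{i \le n} g_i h_{n-i}$, where the product of
  $x + I^{i+1}$ and $y + I^{j+1}$ is $xy + I^{i+j+1}$; it is written as the union over all choices
  of representatives, all of which give the same coset.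
\<close>

definition assoc_graded :: "('a, 'b) ring_scheme \<Rightarrow> 'a set \<Rightarrow> (nat \<Rightarrow> 'a set) ring" where
  "assoc_graded R I =
     \<lparr>carrier = {g. (\<forall>n. g n \<in> (\<lambda>x. ideal_pow R I (Suc n) +>\<^bsub>R\<^esub> x) ` ideal_pow R I n) \<and>
                    finite {n. g n \<noteq> ideal_pow R I (Suc n)}},
      monoid.mult = (\<lambda>g h n. \<Union>{ideal_pow R I (Suc n) +>\<^bsub>R\<^esub> (\<Oplus>\<^bsub>R\<^esub>i\<in>{..n}. x i \<otimes>\<^bsub>R\<^esub> y (n - i)) |
                          x y. \<forall>i\<le>n. x i \<in> g i \<and> y i \<in> h i}),
      one = (\<lambda>n. ideal_pow R I (Suc n) +>\<^bsub>R\<^esub> (if n = 0 then \<one>\<^bsub>R\<^esub> else \<zero>\<^bsub>R\<^esub>)),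
      ring.zero = (\<lambda>n. ideal_pow R I (Suc n)),
      add = (\<lambda>g h n. g n <+>\<^bsub>R\<^esub> h n)\<rparr>"

text \<open>
  For a multiplicative set $S$, the fraction $r/s$ is the class of all pairs $(r',s')$ with
  $u r s' = u r' s$ for some $u \in S$. As above, the operations on classes are unions over all
  choices of representatives.
\<close>

definition fraction :: "('a, 'b) ring_scheme \<Rightarrow> 'a set \<Rightarrow> 'a \<Rightarrow> 'a \<Rightarrow> ('a \<times> 'a) set" where
  "fraction R S r s =
     {(r', s') \<in> carrier R \<times> S.
        \<exists>u\<in>S. u \<otimes>\<^bsub>R\<^esub> (r \<otimes>\<^bsub>R\<^esub> s') = u \<otimes>\<^bsub>R\<^esub> (r' \<otimes>\<^bsub>R\<^esub> s)}"

definition localization :: "('a, 'b) ring_scheme \<Rightarrow> 'a set \<Rightarrow> ('a \<times> 'a) set ring" where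
  "localization R S =
     \<lparr>carrier = {fraction R S r s | r s. r \<in> carrier R \<and> s \<in> S},
      monoid.mult = (\<lambda>F G. \<Union>{fraction R S (r \<otimes>\<^bsub>R\<^esub> r') (s \<otimes>\<^bsub>R\<^esub> s') |
                        r s r' s'. (r, s) \<in> F \<and> (r', s') \<in> G}),
      one = fraction R S \<one>\<^bsub>R\<^esub> \<one>\<^bsub>R\<^esub>,
      ring.zero = fraction R S \<zero>\<^bsub>R\<^esub> \<one>\<^bsub>R\<^esub>,
      add = (\<lambda>F G. \<Union>{fraction R S (r \<otimes>\<^bsub>R\<^esub> s' \<oplus>\<^bsub>R\<^esub> r' \<otimes>\<^bsub>R\<^esub> s) (s \<otimes>\<^bsub>R\<^esub> s') |
                       r s r' s'. (r, s) \<in> F \<and> (r', s') \<in> G})\<rparr>"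

text \<open>The zero ring gets dimension $0$ instead of $-\infty$.\<close>

definition krull_dim :: "('a, 'b) ring_scheme \<Rightarrow> enat" where
  "krull_dim R =
     Sup {enat n | n. \<exists>P. (\<forall>i\<le>n. primeideal (P i) R) \<and> (\<forall>i<n. P i \<subset> P (Suc i))}"

text \<open>
  The second condition says that the $i$-th element is a nonzerodivisor on the quotient of $R$
  by the ideal generated by its predecessors.
\<close>

definition regular_sequence :: "('a, 'b) ring_scheme \<Rightarrow> 'a list \<Rightarrow> bool" where
  "regular_sequence R xs \<longleftrightarrow>
     set xs \<subseteq> carrier R \<and>
     (\<forall>i<length xs. \<forall>y\<in>carrier R.
        (xs ! i) \<otimes>\<^bsub>R\<^esub> y \<in> Idl\<^bsub>R\<^esub> (set (take i xs)) \<longrightarrow> y \<in> Idl\<^bsub>R\<^esub> (set (take i xs))) \<and>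
     Idl\<^bsub>R\<^esub> (set xs) \<noteq> carrier R"

text \<open>For a Noetherian local ring with maximal ideal $M$, this is the depth of the ring.\<close>

definition depth :: "('a, 'b) ring_scheme \<Rightarrow> 'a set \<Rightarrow> enat" where
  "depth R M = Sup {enat (length xs) | xs. regular_sequence R xs \<and> set xs \<subseteq> M}"

definition Cohen_Macaulay_local :: "('a, 'b) ring_scheme \<Rightarrow> bool" where
  "Cohen_Macaulay_local R \<longleftrightarrow>
     cring R \<and> noetherian_ring R \<and>
     (\<exists>M. (\<forall>M'. maximalideal M' R \<longleftrightarrow> M' = M) \<and> depth R M = krull_dim R)"

definition Cohen_Macaulay :: "('a, 'b) ring_scheme \<Rightarrow> bool" where
  "Cohen_Macaulay R \<longleftrightarrow>
     cring R \<and> noetherian_ring R \<and>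
     (\<forall>M. maximalideal M R \<longrightarrow> Cohen_Macaulay_local (localization R (carrier R - M)))"

end

theory Submission
  imports Defs "HOL-Computational_Algebra.Polynomial"
begin

text \<open>
  Write $H = \langle a, a + 1\rangle$, so that $A$ consists of the power series supported in $H$.
  Since $\mathfrak m^{a-1}$ is the conductor of $A$, the ideal $I$ is $A \cap t^s k[[t]]$, and $I^n$
  consists of the series supported in the $n$-fold sumset $E_n$ of $\{h \in H : h \ge s\}$. As
  $t^s$ generates a reduction of $I$, everything depends on whether its initial form is a
  nonzerodivisor on $\mathrm G(I)$, i.e. whether $e \in E_n$ and $e + s \in E_{n+2}$ force
  $e \in E_{n+1}$.

  For $r \in \{0, \ell\}$ the sumsets satisfy $E_{n+1} = s + E_n$ for $n \ge 2$, and the condition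
  holds. Sending a monomial $t^{ns}$ of degree $n$ to $T^n$ and all others to $0$ gives a surjection of
  $\mathrm G(I)$ onto $k[T]$ with nilpotent kernel outside of which all elements are regular, so all
  localizations at maximal ideals have dimension and depth 1. For $0 < r < \ell$ the exponent
  $2s + 2(\ell - r) + 1$ is missing from $E_2$, although $E_n$ contains everything from $ns$ on
  for large $n$; this yields a nonzero element of $\mathrm G(I)$ killed by the irrelevant maximal
  ideal, where the depth is therefore 0 but the dimension is positive.
\<close>

section \<open>Localization\<close>

text \<open>The semigroup \<open>H\<close> is the union of the blocks [a*q, a*q + q], and
  \<open>s\<close> lies in the block q = l. For r = 0 the double sums of this block are a = 2*l + 1
  consecutive integers, a full period; for r = l the element after \<open>s\<close> already opens
  the next block, at s + l + 1. In both cases E_n consists, for n >= 2, of n*s and everything from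
  n*s + r + 1 on. For 0 < r < l the run of double sums starting at 2*s ends at 2*s + 2*(l - r),
  short of s + a*(l + 1); but s and s + 1 both lie in \<open>H\<close>, so n-fold sums fill a run of
  length n + 1, which finally reaches the conductor. The bound a*(a - 1) = 2*a*l <= 2*s supplies the
  socle element: for n >= 2 each integer from n*s on lies in E_(n-1), so every exponent missing from
  E_n is a nonzero monomial of degree n - 1. The definition of Cohen-Macaulay quantifies over all
  maximal ideals, including the non-homogeneous ones. The positive direction therefore rests on
  conditions on elements that pass to every localization at once: elements outside the nilradical
  are regular, and modulo such an x each y satisfies an identity (1 - b*y) * y^n = x*c.\<close>

locale mult_submonoid = cring R for R (structure) +
  fixes S
  assumes S_sub: "S \<subseteq> carrier R" and S_one: "\<one> \<in> S"
    and S_mult: "\<lbrakk>x \<in> S; y \<in> S\<rbrakk> \<Longrightarrow> x \<otimes> y \<in> S"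
begin

abbreviation (input) fr where "fr \<equiv> fraction R S"
abbreviation (input) L where "L \<equiv> localization R S"

lemma S_carr [simp, intro]: "x \<in> S \<Longrightarrow> x \<in> carrier R"
  using S_sub by blast

lemma mem_fr: "(r', s') \<in> fr r s \<longleftrightarrow>
    r' \<in> carrier R \<and> s' \<in> S \<and> (\<exists>u\<in>S. u \<otimes> (r \<otimes> s') = u \<otimes> (r' \<otimes> s))"
  unfolding fraction_def by auto

lemma fr_trans:
  assumes "r \<in> carrier R" "s \<in> S" "r' \<in> carrier R" "s' \<in> S" "r'' \<in> carrier R" "s'' \<in> S"
    and "u \<in> S" "u \<otimes> (r \<otimes> s') = u \<otimes> (r' \<otimes> s)"
    and "v \<in> S" "v \<otimes> (r' \<otimes> s'') = v \<otimes> (r'' \<otimes> s')"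
  shows "\<exists>w\<in>S. w \<otimes> (r \<otimes> s'') = w \<otimes> (r'' \<otimes> s)"
proof
  \<comment> \<open>The middle denominator \<open>s'\<close> joins the witness because it cannot be
    cancelled: \<open>S\<close> may contain zero divisors.\<close>
  show "u \<otimes> v \<otimes> s' \<in> S" using assms S_mult by blast
  note [simp] = S_carr[OF assms(2)] S_carr[OF assms(4)] S_carr[OF assms(6)]
    S_carr[OF assms(7)] S_carr[OF assms(9)] assms(1,3,5)
  have "u \<otimes> v \<otimes> s' \<otimes> (r \<otimes> s'') = (u \<otimes> (r \<otimes> s')) \<otimes> (v \<otimes> s'')"
    by (simp add: m_ac)
  also have "\<dots> = (v \<otimes> (r' \<otimes> s'')) \<otimes> (u \<otimes> s)"
    unfolding assms(8) by (simp add: m_ac)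
  also have "\<dots> = u \<otimes> v \<otimes> s' \<otimes> (r'' \<otimes> s)"
    unfolding assms(10) by (simp add: m_ac)
  finally show "u \<otimes> v \<otimes> s' \<otimes> (r \<otimes> s'') = u \<otimes> v \<otimes> s' \<otimes> (r'' \<otimes> s)" .
qed

lemma fr_eq_iff:
  assumes "r \<in> carrier R" "s \<in> S" "r' \<in> carrier R" "s' \<in> S"
  shows "fr r s = fr r' s' \<longleftrightarrow> (\<exists>u\<in>S. u \<otimes> (r \<otimes> s') = u \<otimes> (r' \<otimes> s))"
proof
  assume "fr r s = fr r' s'"
  moreover have "(r', s') \<in> fr r' s'" using assms S_one mem_fr by auto
  ultimately show "\<exists>u\<in>S. u \<otimes> (r \<otimes> s') = u \<otimes> (r' \<otimes> s)" using mem_fr by metis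
next
  assume "\<exists>u\<in>S. u \<otimes> (r \<otimes> s') = u \<otimes> (r' \<otimes> s)"
  then obtain u where u: "u \<in> S" "u \<otimes> (r \<otimes> s') = u \<otimes> (r' \<otimes> s)" by blast
  show "fr r s = fr r' s'"
  proof (intro subset_antisym subrelI)
    fix x y assume "(x, y) \<in> fr r s"
    then obtain v where v: "x \<in> carrier R" "y \<in> S" "v \<in> S" "v \<otimes> (r \<otimes> y) = v \<otimes> (x \<otimes> s)"
      unfolding mem_fr by blast
    have "\<exists>w\<in>S. w \<otimes> (r' \<otimes> y) = w \<otimes> (x \<otimes> s')"
      by (rule fr_trans[OF assms(3,4) assms(1,2) v(1,2) u(1) u(2)[symmetric] v(3,4)])
    then show "(x, y) \<in> fr r' s'" using v mem_fr by auto
  next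
    fix x y assume "(x, y) \<in> fr r' s'"
    then obtain v where v: "x \<in> carrier R" "y \<in> S" "v \<in> S" "v \<otimes> (r' \<otimes> y) = v \<otimes> (x \<otimes> s')"
      unfolding mem_fr by blast
    have "\<exists>w\<in>S. w \<otimes> (r \<otimes> y) = w \<otimes> (x \<otimes> s)"
      by (rule fr_trans[OF assms v(1,2) u v(3,4)])
    then show "(x, y) \<in> fr r s" using v mem_fr by auto
  qed
qed

lemma fr_self: "r \<in> carrier R \<Longrightarrow> s \<in> S \<Longrightarrow> (r, s) \<in> fr r s"
  unfolding mem_fr using S_one by auto

lemma fr_cancel:
  assumes "r \<in> carrier R" "s \<in> S" "v \<in> S"
  shows "fr (v \<otimes> r) (v \<otimes> s) = fr r s"
  using assms S_mult S_one
  by (subst fr_eq_iff) (auto intro!: bexI[OF _ S_one] simp: m_ac)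

text \<open>The product of classes is a union over all representatives. It collapses to one class
  because the product of the witnesses \<open>u\<close> and \<open>v\<close> identifies any two
  choices.\<close>

lemma fr_mult:
  assumes "r \<in> carrier R" "s \<in> S" "r' \<in> carrier R" "s' \<in> S"
  shows "fr r s \<otimes>\<^bsub>L\<^esub> fr r' s' = fr (r \<otimes> r') (s \<otimes> s')"
proof -
  have "fr (x \<otimes> x') (y \<otimes> y') = fr (r \<otimes> r') (s \<otimes> s')"
    if "(x, y) \<in> fr r s" "(x', y') \<in> fr r' s'" for x y x' y'
  proof -
    from that obtain u v where c: "x \<in> carrier R" "y \<in> S" "x' \<in> carrier R" "y' \<in> S"
      and u: "u \<in> S" "u \<otimes> (r \<otimes> y) = u \<otimes> (x \<otimes> s)"
      and v: "v \<in> S" "v \<otimes> (r' \<otimes> y') = v \<otimes> (x' \<otimes> s')" unfolding mem_fr by blast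
    note [simp] = S_carr[OF assms(2)] S_carr[OF assms(4)] S_carr[OF c(2)] S_carr[OF c(4)]
      assms(1,3) c(1,3) S_carr[OF u(1)] S_carr[OF v(1)]
    have "(u \<otimes> v) \<otimes> (r \<otimes> r' \<otimes> (y \<otimes> y')) = (u \<otimes> (r \<otimes> y)) \<otimes> (v \<otimes> (r' \<otimes> y'))"
      by (simp add: m_ac)
    also have "\<dots> = (u \<otimes> v) \<otimes> (x \<otimes> x' \<otimes> (s \<otimes> s'))"
      unfolding u v by (simp add: m_ac)
    finally show ?thesis
      using S_mult assms c u v by (subst fr_eq_iff) (auto intro!: bexI[of _ "u \<otimes> v"])
  qed
  then have *: "{fr (x \<otimes> x') (y \<otimes> y') | x y x' y'. (x, y) \<in> fr r s \<and> (x', y') \<in> fr r' s'}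
      = {fr (r \<otimes> r') (s \<otimes> s')}"
    using fr_self[OF assms(1,2)] fr_self[OF assms(3,4)] by blast
  show ?thesis unfolding localization_def by (simp add: *)
qed

lemma fr_add:
  assumes "r \<in> carrier R" "s \<in> S" "r' \<in> carrier R" "s' \<in> S"
  shows "fr r s \<oplus>\<^bsub>L\<^esub> fr r' s' = fr (r \<otimes> s' \<oplus> r' \<otimes> s) (s \<otimes> s')"
proof -
  have "fr (x \<otimes> y' \<oplus> x' \<otimes> y) (y \<otimes> y') = fr (r \<otimes> s' \<oplus> r' \<otimes> s) (s \<otimes> s')"
    if "(x, y) \<in> fr r s" "(x', y') \<in> fr r' s'" for x y x' y'
  proof -
    from that obtain u v where c: "x \<in> carrier R" "y \<in> S" "x' \<in> carrier R" "y' \<in> S"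
      and u: "u \<in> S" "u \<otimes> (r \<otimes> y) = u \<otimes> (x \<otimes> s)"
      and v: "v \<in> S" "v \<otimes> (r' \<otimes> y') = v \<otimes> (x' \<otimes> s')" unfolding mem_fr by blast
    note [simp] = S_carr[OF assms(2)] S_carr[OF assms(4)] S_carr[OF c(2)] S_carr[OF c(4)]
      assms(1,3) c(1,3) S_carr[OF u(1)] S_carr[OF v(1)]
    have "(u \<otimes> v) \<otimes> ((r \<otimes> s' \<oplus> r' \<otimes> s) \<otimes> (y \<otimes> y'))
       = (u \<otimes> (r \<otimes> y)) \<otimes> (v \<otimes> s' \<otimes> y') \<oplus> (v \<otimes> (r' \<otimes> y')) \<otimes> (u \<otimes> s \<otimes> y)"
      by (simp add: m_ac l_distr r_distr)
    also have "\<dots> = (u \<otimes> v) \<otimes> ((x \<otimes> y' \<oplus> x' \<otimes> y) \<otimes> (s \<otimes> s'))"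
      unfolding u v by (simp add: m_ac l_distr r_distr)
    finally show ?thesis
      using S_mult assms c u v by (subst fr_eq_iff) (auto intro!: bexI[of _ "u \<otimes> v"])
  qed
  then have *: "{fr (x \<otimes> y' \<oplus> x' \<otimes> y) (y \<otimes> y') | x y x' y'. (x, y) \<in> fr r s \<and> (x', y') \<in> fr r' s'}
      = {fr (r \<otimes> s' \<oplus> r' \<otimes> s) (s \<otimes> s')}"
    using fr_self[OF assms(1,2)] fr_self[OF assms(3,4)] by blast
  show ?thesis unfolding localization_def by (simp add: *)
qed

lemma L_carrier: "carrier L = {fr r s | r s. r \<in> carrier R \<and> s \<in> S}"
  and L_one: "\<one>\<^bsub>L\<^esub> = fr \<one> \<one>" and L_zero: "\<zero>\<^bsub>L\<^esub> = fr \<zero> \<one>"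
  unfolding localization_def by simp_all

lemma fr_carrier [simp, intro]: "r \<in> carrier R \<Longrightarrow> s \<in> S \<Longrightarrow> fr r s \<in> carrier L"
  unfolding L_carrier by blast

lemma L_carrierE:
  assumes "x \<in> carrier L" obtains r s where "r \<in> carrier R" "s \<in> S" "x = fr r s"
  using assms unfolding L_carrier by blast

lemma L_cring: "cring L"
proof (rule cringI)
  show "abelian_group L"
  proof (rule abelian_groupI)
    fix x y assume "x \<in> carrier L" "y \<in> carrier L"
    then show "x \<oplus>\<^bsub>L\<^esub> y \<in> carrier L"
      by (elim L_carrierE) (simp add: fr_add S_mult)
  next
    show "\<zero>\<^bsub>L\<^esub> \<in> carrier L" by (simp add: L_zero S_one)
  next
    fix x y z assume "x \<in> carrier L" "y \<in> carrier L" "z \<in> carrier L"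
    then show "x \<oplus>\<^bsub>L\<^esub> y \<oplus>\<^bsub>L\<^esub> z = x \<oplus>\<^bsub>L\<^esub> (y \<oplus>\<^bsub>L\<^esub> z)"
      by (elim L_carrierE) (simp add: fr_add S_mult m_ac l_distr r_distr a_ac)
  next
    fix x y assume "x \<in> carrier L" "y \<in> carrier L"
    then show "x \<oplus>\<^bsub>L\<^esub> y = y \<oplus>\<^bsub>L\<^esub> x"
      by (elim L_carrierE) (simp add: fr_add S_mult m_ac a_ac)
  next
    fix x assume "x \<in> carrier L"
    then show "\<zero>\<^bsub>L\<^esub> \<oplus>\<^bsub>L\<^esub> x = x"
      by (elim L_carrierE) (simp add: fr_add S_one L_zero)
  next
    fix x assume "x \<in> carrier L"
    then obtain r s where x: "r \<in> carrier R" "s \<in> S" "x = fr r s" by (elim L_carrierE)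
    have "fr (\<ominus> r) s \<oplus>\<^bsub>L\<^esub> x = fr (\<ominus> r \<otimes> s \<oplus> r \<otimes> s) (s \<otimes> s)" using x by (simp add: fr_add)
    also have "\<dots> = \<zero>\<^bsub>L\<^esub>" unfolding L_zero using x
      by (subst fr_eq_iff) (auto intro!: bexI[OF _ S_one] S_one S_mult simp: l_minus l_neg)
    finally show "\<exists>y\<in>carrier L. y \<oplus>\<^bsub>L\<^esub> x = \<zero>\<^bsub>L\<^esub>" using x by blast
  qed
next
  show "comm_monoid L"
  proof (rule comm_monoidI)
    fix x y assume "x \<in> carrier L" "y \<in> carrier L"
    then show "x \<otimes>\<^bsub>L\<^esub> y \<in> carrier L"
      by (elim L_carrierE) (simp add: fr_mult S_mult)
  next
    show "\<one>\<^bsub>L\<^esub> \<in> carrier L" by (simp add: L_one S_one)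
  next
    fix x y z assume "x \<in> carrier L" "y \<in> carrier L" "z \<in> carrier L"
    then show "x \<otimes>\<^bsub>L\<^esub> y \<otimes>\<^bsub>L\<^esub> z = x \<otimes>\<^bsub>L\<^esub> (y \<otimes>\<^bsub>L\<^esub> z)"
      by (elim L_carrierE) (simp add: fr_mult S_mult m_ac)
  next
    fix x y assume "x \<in> carrier L" "y \<in> carrier L"
    then show "x \<otimes>\<^bsub>L\<^esub> y = y \<otimes>\<^bsub>L\<^esub> x"
      by (elim L_carrierE) (simp add: fr_mult S_mult m_ac)
  next
    fix x assume "x \<in> carrier L"
    then show "\<one>\<^bsub>L\<^esub> \<otimes>\<^bsub>L\<^esub> x = x"
      by (elim L_carrierE) (simp add: fr_mult S_one L_one)
  qed
next
  fix x y z assume "x \<in> carrier L" "y \<in> carrier L" "z \<in> carrier L"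
  then obtain r s r' s' r'' s'' where c: "r \<in> carrier R" "s \<in> S" "r' \<in> carrier R" "s' \<in> S"
    "r'' \<in> carrier R" "s'' \<in> S" and xyz: "x = fr r s" "y = fr r' s'" "z = fr r'' s''"
    by (elim L_carrierE)
  \<comment> \<open>Adding over the common denominator leaves one surplus factor \<open>s''\<close>
    above and below; \<open>fr_cancel\<close> removes it.\<close>
  have "x \<otimes>\<^bsub>L\<^esub> z \<oplus>\<^bsub>L\<^esub> y \<otimes>\<^bsub>L\<^esub> z
      = fr (s'' \<otimes> ((r \<otimes> s' \<oplus> r' \<otimes> s) \<otimes> r'')) (s'' \<otimes> (s \<otimes> s' \<otimes> s''))"
    using c unfolding xyz by (simp add: fr_mult fr_add S_mult m_ac l_distr r_distr)
  also have "\<dots> = (x \<oplus>\<^bsub>L\<^esub> y) \<otimes>\<^bsub>L\<^esub> z"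
    using c unfolding xyz by (subst fr_cancel) (simp_all add: fr_mult fr_add S_mult)
  finally show "(x \<oplus>\<^bsub>L\<^esub> y) \<otimes>\<^bsub>L\<^esub> z = x \<otimes>\<^bsub>L\<^esub> z \<oplus>\<^bsub>L\<^esub> y \<otimes>\<^bsub>L\<^esub> z" ..
qed

sublocale L: cring L by (rule L_cring)

lemma fr_zero_iff:
  assumes "r \<in> carrier R" "s \<in> S"
  shows "fr r s = \<zero>\<^bsub>L\<^esub> \<longleftrightarrow> (\<exists>u\<in>S. u \<otimes> r = \<zero>)"
  unfolding L_zero using assms S_one by (subst fr_eq_iff) auto

lemma fr_split:
  assumes "r \<in> carrier R" "s \<in> S"
  shows "fr r s = fr \<one> s \<otimes>\<^bsub>L\<^esub> fr r \<one>" and "fr r \<one> = fr s \<one> \<otimes>\<^bsub>L\<^esub> fr r s"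
proof -
  show "fr r s = fr \<one> s \<otimes>\<^bsub>L\<^esub> fr r \<one>" using assms S_one by (simp add: fr_mult)
  show "fr r \<one> = fr s \<one> \<otimes>\<^bsub>L\<^esub> fr r s"
    using assms S_one fr_cancel[of r \<one> s] by (simp add: fr_mult)
qed

lemma fr_hom: "(\<lambda>r. fr r \<one>) \<in> ring_hom R L"
  by (rule ring_hom_memI) (simp_all add: S_one fr_mult fr_add L_one)

lemma fr_inverse:
  assumes "r \<in> S" "s \<in> S" shows "fr s r \<otimes>\<^bsub>L\<^esub> fr r s = \<one>\<^bsub>L\<^esub>"
  using assms S_mult[of r s] S_one fr_cancel[of \<one> \<one> "r \<otimes> s"] by (simp add: fr_mult L_one m_ac)

text \<open>Passing between the two fractions multiplies by \<open>fr \<one> s\<close> or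
  \<open>fr s \<one>\<close>, so an ideal sees only numerators.\<close>

lemma ideal_fr_iff:
  assumes "ideal Q L" "r \<in> carrier R" "s \<in> S"
  shows "fr r s \<in> Q \<longleftrightarrow> fr r \<one> \<in> Q"
proof -
  interpret Q: ideal Q L by fact
  show ?thesis
    using fr_split[OF assms(2,3)] assms(2,3) S_one Q.I_l_closed
    by (metis fr_carrier S_carr one_closed)
qed

lemma contract_prime:
  assumes "primeideal Q L"
  shows "primeideal {r \<in> carrier R. fr r \<one> \<in> Q} R"
proof -
  interpret h: ring_hom_ring R L "\<lambda>r. fr r \<one>"
    by unfold_locales (rule fr_hom)
  show ?thesis by (rule h.primeideal_vimage[OF is_cring assms])
qed

lemma extend_ideal:
  assumes "ideal P R"
  shows "ideal {fr r s | r s. r \<in> P \<and> s \<in> S} L"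
proof -
  interpret P: ideal P R by fact
  let ?Q = "{fr r s | r s. r \<in> P \<and> s \<in> S}"
  show ?thesis
  proof (rule idealI)
    show "ring L" by (rule L.ring_axioms)
    show "subgroup ?Q (add_monoid L)"
    proof (rule L.add.subgroupI)
      show "?Q \<subseteq> carrier L" using P.Icarr by auto
      show "?Q \<noteq> {}" using P.zero_closed S_one by blast
    next
      fix x assume "x \<in> ?Q"
      then obtain r s where x: "r \<in> P" "s \<in> S" "x = fr r s" by blast
      have "fr (\<ominus> r) s \<oplus>\<^bsub>L\<^esub> x = fr (\<ominus> r \<otimes> s \<oplus> r \<otimes> s) (s \<otimes> s)" using x P.Icarr by (simp add: fr_add)
      also have "\<dots> = \<zero>\<^bsub>L\<^esub>" unfolding L_zero using x P.Icarr
        by (subst fr_eq_iff) (auto intro!: bexI[OF _ S_one] S_one S_mult simp: l_minus l_neg)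
      finally have "\<ominus>\<^bsub>L\<^esub> x = fr (\<ominus> r) s"
        using x P.Icarr by (intro L.minus_equality) simp_all
      then show "\<ominus>\<^bsub>L\<^esub> x \<in> ?Q" using x by auto
    next
      fix x y assume "x \<in> ?Q" "y \<in> ?Q"
      then obtain r s r' s' where "r \<in> P" "s \<in> S" "x = fr r s" "r' \<in> P" "s' \<in> S" "y = fr r' s'"
        by auto
      then have "x \<oplus>\<^bsub>L\<^esub> y = fr (r \<otimes> s' \<oplus> r' \<otimes> s) (s \<otimes> s')" "s \<otimes> s' \<in> S"
        "r \<otimes> s' \<oplus> r' \<otimes> s \<in> P"
        using P.Icarr P.I_r_closed P.a_closed S_mult by (simp_all add: fr_add)
      then show "x \<oplus>\<^bsub>L\<^esub> y \<in> ?Q" by blast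
    qed
    fix x y assume "x \<in> ?Q" "y \<in> carrier L"
    then obtain r s r' s' where xy: "r \<in> P" "s \<in> S" "x = fr r s" "r' \<in> carrier R" "s' \<in> S" "y = fr r' s'"
      by (auto elim!: L_carrierE)
    then have "y \<otimes>\<^bsub>L\<^esub> x = fr (r' \<otimes> r) (s' \<otimes> s)" "x \<otimes>\<^bsub>L\<^esub> y = fr (r \<otimes> r') (s \<otimes> s')"
      "s' \<otimes> s \<in> S" "s \<otimes> s' \<in> S" "r' \<otimes> r \<in> P" "r \<otimes> r' \<in> P"
      using P.Icarr P.I_l_closed P.I_r_closed S_mult by (simp_all add: fr_mult)
    then show "y \<otimes>\<^bsub>L\<^esub> x \<in> ?Q" "x \<otimes>\<^bsub>L\<^esub> y \<in> ?Q" by blast+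
  qed
qed

text \<open>The extended set only asks for some representative with numerator in \<open>P\<close>.
  Primeness makes this independent of the representative: the factors \<open>u\<close> and
  \<open>s'\<close> lie in \<open>S\<close>, hence outside \<open>P\<close>.\<close>

lemma extend_prime_iff:
  assumes "primeideal P R" "P \<inter> S = {}" "r \<in> carrier R" "s \<in> S"
  shows "fr r s \<in> {fr r s | r s. r \<in> P \<and> s \<in> S} \<longleftrightarrow> r \<in> P"
proof
  interpret P: primeideal P R by fact
  assume "fr r s \<in> {fr r s | r s. r \<in> P \<and> s \<in> S}"
  then obtain r' s' where p: "r' \<in> P" "s' \<in> S" and "fr r s = fr r' s'" by blast
  then obtain u where u: "u \<in> S" "u \<otimes> (r \<otimes> s') = u \<otimes> (r' \<otimes> s)"
    using assms P.Icarr by (subst (asm) fr_eq_iff) auto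
  have "u \<otimes> (r \<otimes> s') \<in> P" unfolding u(2) using u(1) p assms by (intro P.I_l_closed P.I_r_closed) auto
  then show "r \<in> P" using P.I_prime assms p u by (metis S_carr m_closed disjoint_iff)
qed (use assms in blast)

lemma extend_prime:
  assumes "primeideal P R" "P \<inter> S = {}"
  shows "primeideal {fr r s | r s. r \<in> P \<and> s \<in> S} L"
proof -
  interpret P: primeideal P R by fact
  let ?Q = "{fr r s | r s. r \<in> P \<and> s \<in> S}"
  show ?thesis
  proof (rule primeidealI)
    show "ideal ?Q L" by (rule extend_ideal) (rule P.ideal_axioms)
    show "cring L" by (rule L_cring)
    have "\<one>\<^bsub>L\<^esub> \<notin> ?Q" unfolding L_one using extend_prime_iff[OF assms one_closed S_one] assms S_one by auto
    then show "carrier L \<noteq> ?Q" using L.one_closed by blast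
  next
    fix x y assume "x \<in> carrier L" "y \<in> carrier L" and m: "x \<otimes>\<^bsub>L\<^esub> y \<in> ?Q"
    then obtain r s r' s' where xy: "r \<in> carrier R" "s \<in> S" "x = fr r s" "r' \<in> carrier R" "s' \<in> S" "y = fr r' s'"
      by (auto elim!: L_carrierE)
    from m have "fr (r \<otimes> r') (s \<otimes> s') \<in> ?Q" using xy by (simp only: fr_mult)
    then have "r \<otimes> r' \<in> P" using extend_prime_iff[OF assms] xy S_mult by simp
    then have "r \<in> P \<or> r' \<in> P" using P.I_prime xy by blast
    then show "x \<in> ?Q \<or> y \<in> ?Q" using xy by blast
  qed
qed

text \<open>An ideal is determined by its contraction to \<open>R\<close>, so the images of finitely
  many generators of the contraction generate it.\<close>

lemma L_noetherian:
  assumes "noetherian_ring R"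
  shows "noetherian_ring L"
proof (rule L.noetherian_ringI)
  interpret N: noetherian_ring R by fact
  interpret h: ring_hom_ring R L "\<lambda>r. fr r \<one>" by unfold_locales (rule fr_hom)
  fix Q assume Q: "ideal Q L"
  interpret Q: ideal Q L by fact
  let ?P = "{r \<in> carrier R. fr r \<one> \<in> Q}"
  have P: "ideal ?P R" using h.ideal_vimage[OF Q] .
  then obtain A where A: "A \<subseteq> carrier R" "finite A" "?P = Idl A" using N.finetely_gen by blast
  let ?B = "(\<lambda>r. fr r \<one>) ` A"
  have Bc: "?B \<subseteq> carrier L" using A S_one by auto
  have "Idl\<^bsub>L\<^esub> ?B = Q"
  proof
    have "?B \<subseteq> Q" using genideal_self[OF A(1)] A(3) by blast
    then show "Idl\<^bsub>L\<^esub> ?B \<subseteq> Q" by (rule L.genideal_minimal[OF Q])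
    have I: "ideal (Idl\<^bsub>L\<^esub> ?B) L" by (rule L.genideal_ideal[OF Bc])
    have "A \<subseteq> {r \<in> carrier R. fr r \<one> \<in> Idl\<^bsub>L\<^esub> ?B}" using L.genideal_self[OF Bc] A(1) by blast
    then have "?P \<subseteq> {r \<in> carrier R. fr r \<one> \<in> Idl\<^bsub>L\<^esub> ?B}"
      unfolding A(3) by (rule genideal_minimal[OF h.ideal_vimage[OF I]])
    then have *: "fr r \<one> \<in> Idl\<^bsub>L\<^esub> ?B" if "r \<in> carrier R" "fr r \<one> \<in> Q" for r using that by blast
    show "Q \<subseteq> Idl\<^bsub>L\<^esub> ?B"
    proof
      fix x assume x: "x \<in> Q"
      then obtain r s where "r \<in> carrier R" "s \<in> S" "x = fr r s" using Q.Icarr L_carrierE by metis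
      then show "x \<in> Idl\<^bsub>L\<^esub> ?B" using x * ideal_fr_iff[OF Q] ideal_fr_iff[OF I] by simp
    qed
  qed
  then show "\<exists>A\<subseteq>carrier L. finite A \<and> Q = Idl\<^bsub>L\<^esub> A" using Bc A(2) by blast
qed

end

lemma (in cring) mult_submonoid_compl_prime:
  assumes "primeideal P R" shows "mult_submonoid R (carrier R - P)"
proof -
  interpret P: primeideal P R by fact
  have "\<one> \<notin> P" using P.one_imp_carrier P.I_notcarr by metis
  then show ?thesis
    using P.I_prime by unfold_locales auto
qed

section \<open>The localization at a prime is a local ring\<close>

context mult_submonoid
begin

text \<open>A fraction whose numerator avoids \<open>M\<close> is a unit, its inverse being the
  swapped fraction.\<close>

lemma proper_ideal_subset_extension:
  assumes M: "S = carrier R - M" and "ideal J L" "J \<noteq> carrier L"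
  shows "J \<subseteq> {fr r s | r s. r \<in> M \<and> s \<in> S}"
proof
  interpret J: ideal J L by fact
  fix x assume x: "x \<in> J"
  then obtain r s where rs: "r \<in> carrier R" "s \<in> S" "x = fr r s" using J.Icarr L_carrierE by metis
  have "r \<in> M"
  proof (rule ccontr)
    assume "r \<notin> M"
    then have r: "r \<in> S" using rs M by simp
    have "fr s r \<otimes>\<^bsub>L\<^esub> x \<in> J" using x r rs by (intro J.I_l_closed) auto
    then have "\<one>\<^bsub>L\<^esub> \<in> J" using fr_inverse[OF r rs(2)] rs(3) by simp
    then show False using J.one_imp_carrier assms(3) by blast
  qed
  then show "x \<in> {fr r s | r s. r \<in> M \<and> s \<in> S}" using rs by blast
qed

lemma maximal_iff_extension:
  assumes M: "S = carrier R - M" and P: "primeideal M R"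
  shows "maximalideal M' L \<longleftrightarrow> M' = {fr r s | r s. r \<in> M \<and> s \<in> S}" (is "_ \<longleftrightarrow> _ = ?E")
proof -
  have E: "primeideal ?E L" by (rule extend_prime[OF P]) (use M in blast)
  interpret E: primeideal ?E L by (rule E)
  have max: "maximalideal ?E L"
  proof (rule maximalidealI)
    show "ideal ?E L" by (rule E.ideal_axioms)
    show "carrier L \<noteq> ?E" by (rule E.I_notcarr)
  qed (use proper_ideal_subset_extension[OF M] in blast)
  show ?thesis
  proof
    assume "maximalideal M' L"
    then interpret M': maximalideal M' L .
    have "M' \<subseteq> ?E" using proper_ideal_subset_extension[OF M M'.ideal_axioms] M'.I_notcarr by blast
    then show "M' = ?E" using M'.I_maximal[OF E.ideal_axioms] E.I_notcarr E.Icarr by blast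
  qed (use max in blast)
qed

text \<open>Together with \<open>contract_prime\<close> this turns chains of primes of the
  localization into chains in \<open>R\<close>, where the dimension can be bounded.\<close>

lemma contract_strict:
  assumes "ideal Q L" "ideal Q' L" "Q \<subset> Q'"
  shows "{r \<in> carrier R. fr r \<one> \<in> Q} \<subset> {r \<in> carrier R. fr r \<one> \<in> Q'}"
proof -
  interpret Q': ideal Q' L by fact
  obtain x where x: "x \<in> Q'" "x \<notin> Q" using assms by blast
  then obtain r s where rs: "r \<in> carrier R" "s \<in> S" "x = fr r s" using Q'.Icarr L_carrierE by metis
  then have "fr r \<one> \<in> Q'" "fr r \<one> \<notin> Q" using x ideal_fr_iff assms by blast+
  then show ?thesis using assms(3) rs by blast
qed

end

lemma (in ring) genideal_empty: "Idl {} = {\<zero>}"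
proof
  show "Idl {} \<subseteq> {\<zero>}" by (rule genideal_minimal[OF zeroideal]) simp
  interpret I: ideal "Idl {}" R by (rule genideal_ideal) simp
  show "{\<zero>} \<subseteq> Idl {}" using I.zero_closed by blast
qed

text \<open>At \<open>M\<close> the depth is 0: every element of the maximal ideal kills the image
  of \<open>w\<close>, and this image is nonzero because no element outside \<open>M\<close> kills
  \<open>w\<close>. The chain from \<open>P\<close> to \<open>M\<close> survives in the
  localization, so the dimension is at least 1.\<close>

lemma (in cring) not_Cohen_Macaulay_if_socle:
  assumes P: "primeideal P R" and M: "maximalideal M R" and PM: "P \<subset> M"
    and w: "w \<in> carrier R" "w \<noteq> \<zero>" and Mw: "\<And>x. x \<in> M \<Longrightarrow> x \<otimes> w = \<zero>"
  shows "\<not> Cohen_Macaulay R"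
proof
  interpret M: maximalideal M R by fact
  have Mp: "primeideal M R" by (rule maximalideal_prime[OF M])
  define S where "S = carrier R - M"
  interpret mult_submonoid R S unfolding S_def by (rule mult_submonoid_compl_prime[OF Mp])
  define E where "E = {fr r s | r s. r \<in> M \<and> s \<in> S}"
  have E: "primeideal E L" unfolding E_def by (rule extend_prime[OF Mp]) (simp add: S_def)
  interpret E: primeideal E L by fact
  assume "Cohen_Macaulay R"
  then have "Cohen_Macaulay_local L" using M unfolding Cohen_Macaulay_def S_def by blast
  then have dd: "depth L E = krull_dim L"
    unfolding Cohen_Macaulay_local_def maximal_iff_extension[OF S_def Mp] E_def by metis
  define Q where "Q = {fr r s | r s. r \<in> P \<and> s \<in> S}"
  have PS: "P \<inter> S = {}" using PM S_def by blast
  have Q: "primeideal Q L" unfolding Q_def by (rule extend_prime[OF P PS])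
  obtain x where x: "x \<in> M" "x \<notin> P" using PM by blast
  have "fr x \<one> \<in> E" using x S_one unfolding E_def by blast
  moreover have "fr x \<one> \<notin> Q" unfolding Q_def
    using extend_prime_iff[OF P PS, of x \<one>] x M.Icarr S_one by blast
  moreover have "Q \<subseteq> E" using PM unfolding Q_def E_def by blast
  ultimately have "Q \<subset> E" by blast
  then have "\<exists>F. (\<forall>i\<le>1. primeideal (F i) L) \<and> (\<forall>i<1. F i \<subset> F (Suc i))"
    using E Q by (intro exI[of _ "\<lambda>i::nat. if i = 0 then Q else E"]) auto
  then have dim: "enat 1 \<le> krull_dim L" unfolding krull_dim_def by (intro Sup_upper) blast
  have "xs = []" if xs: "regular_sequence L xs" "set xs \<subseteq> E" for xs
  proof (rule ccontr)
    assume "xs \<noteq> []"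
    then have len: "0 < length xs" and x0: "xs ! 0 \<in> E" using xs(2) by auto
    then obtain r s where rs: "r \<in> M" "s \<in> S" "xs ! 0 = fr r s" unfolding E_def by blast
    have w1: "fr w \<one> \<in> carrier L" using w S_one by blast
    \<comment> \<open>The first entry of a regular sequence is tested modulo the ideal generated by
      the empty set, which is zero.\<close>
    have "xs ! 0 \<otimes>\<^bsub>L\<^esub> fr w \<one> = fr \<zero> s" using rs M.Icarr w S_one Mw by (simp add: fr_mult)
    also have "\<dots> = \<zero>\<^bsub>L\<^esub>" using rs S_one by (subst fr_zero_iff) auto
    finally have "xs ! 0 \<otimes>\<^bsub>L\<^esub> fr w \<one> \<in> Idl\<^bsub>L\<^esub> (set (take 0 xs))" by (simp add: L.genideal_empty)
    then have "fr w \<one> \<in> Idl\<^bsub>L\<^esub> (set (take 0 xs))"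
      using xs(1) len w1 unfolding regular_sequence_def by blast
    then have "fr w \<one> = \<zero>\<^bsub>L\<^esub>" by (simp add: L.genideal_empty)
    then obtain u where u: "u \<in> S" "u \<otimes> w = \<zero>" using fr_zero_iff w S_one by blast
    have uc: "u \<in> carrier R" using u by blast
    text \<open>The annihilator of \<^term>\<open>w\<close> contains \<^term>\<open>M\<close> and \<^term>\<open>u\<close>, hence 1.\<close>
    let ?A = "{x \<in> carrier R. x \<otimes> w = \<zero>}"
    have A: "ideal ?A R"
    proof (rule idealI)
      show "subgroup ?A (add_monoid R)"
        by (rule add.subgroupI) (use w in \<open>auto simp: l_distr l_minus\<close>)
    next
      fix a x assume "a \<in> ?A" "x \<in> carrier R"
      then have "x \<otimes> a \<otimes> w = x \<otimes> (a \<otimes> w)" "a \<otimes> x \<otimes> w = x \<otimes> (a \<otimes> w)" "a \<otimes> w = \<zero>"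
        "a \<in> carrier R" "x \<in> carrier R"
        using w by (simp_all only: m_assoc m_comm[of a x] mem_Collect_eq)
      then show "x \<otimes> a \<in> ?A" "a \<otimes> x \<in> ?A" by simp_all
    qed (rule ring_axioms)
    have "?A = M \<or> ?A = carrier R" by (rule M.I_maximal[OF A]) (use Mw M.Icarr in auto)
    moreover have "?A \<noteq> M" using u uc S_def by blast
    ultimately have "\<one> \<otimes> w = \<zero>" using one_closed by blast
    then show False using w by simp
  qed
  then have "depth L E \<le> 0" unfolding depth_def
    by (intro Sup_least) (auto simp: zero_enat_def)
  then have "enat 1 \<le> enat 0" using dim dd unfolding zero_enat_def by (metis order_trans)
  then show False by simp
qed

section \<open>One-dimensional Cohen--Macaulay rings\<close>

lemma (in cring) nilpotent_in_primeideal: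
  assumes P: "primeideal P R" and "x \<in> carrier R" "x [^] (n::nat) = \<zero>"
  shows "x \<in> P"
proof -
  interpret P: primeideal P R by fact
  have "x [^] n \<in> P \<Longrightarrow> x \<in> P" for n :: nat
  proof (induction n)
    case 0
    then show ?case using P.one_imp_carrier P.I_notcarr by auto
  next
    case (Suc n)
    then show ?case using P.I_prime assms(2) by (metis nat_pow_Suc nat_pow_closed)
  qed
  then show ?thesis using assms P.zero_closed by metis
qed

lemma regular_sequence_singleton:
  "regular_sequence R [x] \<longleftrightarrow> x \<in> carrier R \<and>
    (\<forall>z\<in>carrier R. x \<otimes>\<^bsub>R\<^esub> z \<in> Idl\<^bsub>R\<^esub> {} \<longrightarrow> z \<in> Idl\<^bsub>R\<^esub> {}) \<and> Idl\<^bsub>R\<^esub> {x} \<noteq> carrier R"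
  unfolding regular_sequence_def by simp

lemma regular_sequence_Cons_Cons:
  assumes "regular_sequence R (x # y # zs)"
  shows "\<And>z. \<lbrakk>z \<in> carrier R; x \<otimes>\<^bsub>R\<^esub> z \<in> Idl\<^bsub>R\<^esub> {}\<rbrakk> \<Longrightarrow> z \<in> Idl\<^bsub>R\<^esub> {}"
    and "\<And>z. \<lbrakk>z \<in> carrier R; y \<otimes>\<^bsub>R\<^esub> z \<in> Idl\<^bsub>R\<^esub> {x}\<rbrakk> \<Longrightarrow> z \<in> Idl\<^bsub>R\<^esub> {x}"
proof -
  have *: "\<forall>i<length (x # y # zs). \<forall>z\<in>carrier R.
      (x # y # zs) ! i \<otimes>\<^bsub>R\<^esub> z \<in> Idl\<^bsub>R\<^esub> (set (take i (x # y # zs)))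
      \<longrightarrow> z \<in> Idl\<^bsub>R\<^esub> (set (take i (x # y # zs)))"
    using assms unfolding regular_sequence_def by blast
  show "z \<in> Idl\<^bsub>R\<^esub> {}" if "z \<in> carrier R" "x \<otimes>\<^bsub>R\<^esub> z \<in> Idl\<^bsub>R\<^esub> {}" for z
    using *[rule_format, of 0 z] that by simp
  show "z \<in> Idl\<^bsub>R\<^esub> {x}" if "z \<in> carrier R" "y \<otimes>\<^bsub>R\<^esub> z \<in> Idl\<^bsub>R\<^esub> {x}" for z
    using *[rule_format, of 1 z] that by simp
qed

text \<open>
  The last hypothesis says that \<open>R/xR\<close> is zero-dimensional for every \<open>x\<close> outside the nilradical,
  in a form that needs no prime ideals.
\<close>

lemma (in noetherian_ring) Cohen_Macaulay_if_one_dimensional: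
  assumes "cring R" and N: "primeideal N R" "\<not> maximalideal N R"
    and nil: "\<And>x. x \<in> N \<Longrightarrow> \<exists>n::nat. x [^] n = \<zero>"
    and reg: "\<And>x y. \<lbrakk>x \<in> carrier R; x \<notin> N; y \<in> carrier R; x \<otimes> y = \<zero>\<rbrakk> \<Longrightarrow> y = \<zero>"
    and zdim: "\<And>x y. \<lbrakk>x \<in> carrier R; x \<notin> N; y \<in> carrier R\<rbrakk> \<Longrightarrow>
      \<exists>(n::nat). \<exists>b\<in>carrier R. \<exists>c\<in>carrier R. (\<one> \<ominus> b \<otimes> y) \<otimes> y [^] n = x \<otimes> c"
  shows "Cohen_Macaulay R"
proof -
  interpret cring R by fact
  interpret N: primeideal N R by fact
  have N_sub: "N \<subseteq> P" if "primeideal P R" for P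
    using nilpotent_in_primeideal[OF that] nil N.Icarr by blast
  show ?thesis unfolding Cohen_Macaulay_def
  proof (intro conjI allI impI)
    show "cring R" by (rule is_cring)
    show "noetherian_ring R" by (rule noetherian_ring_axioms)
    fix M assume M: "maximalideal M R"
    interpret M: maximalideal M R by fact
    have Mp: "primeideal M R" by (rule maximalideal_prime[OF M])
    have one_M: "\<one> \<notin> M" using M.one_imp_carrier M.I_notcarr by metis
    define S where "S = carrier R - M"
    interpret mult_submonoid R S unfolding S_def by (rule mult_submonoid_compl_prime[OF Mp])
    define E where "E = {fr r s | r s. r \<in> M \<and> s \<in> S}"
    have E: "primeideal E L" unfolding E_def by (rule extend_prime[OF Mp]) (simp add: S_def)
    interpret E: primeideal E L by fact
    have NM: "N \<subseteq> M" by (rule N_sub[OF Mp])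
    have NS: "N \<inter> S = {}" using NM S_def by blast
    define Q where "Q = {fr r s | r s. r \<in> N \<and> s \<in> S}"
    have Q: "primeideal Q L" unfolding Q_def by (rule extend_prime[OF N(1) NS])
    have "N \<noteq> M" using N(2) M by metis
    then obtain x where x: "x \<in> M" "x \<notin> N" using NM by blast
    have xc: "x \<in> carrier R" using x M.Icarr by blast
    have xE: "fr x \<one> \<in> E" using x S_one unfolding E_def by blast
    have "fr x \<one> \<notin> Q" unfolding Q_def using extend_prime_iff[OF N(1) NS xc S_one] x by blast
    moreover have "Q \<subseteq> E" using NM unfolding Q_def E_def by blast
    ultimately have "Q \<subset> E" using xE by blast
    then have "\<exists>F. (\<forall>i\<le>1. primeideal (F i) L) \<and> (\<forall>i<1. F i \<subset> F (Suc i))"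
      using E Q by (intro exI[of _ "\<lambda>i::nat. if i = 0 then Q else E"]) auto
    then have dim_ge: "enat 1 \<le> krull_dim L" unfolding krull_dim_def by (intro Sup_upper) blast
    have dim_le: "n \<le> 1" if F: "\<forall>i\<le>n. primeideal (F i) L" "\<forall>i<n. F i \<subset> F (Suc i)" for n and F
    proof (rule ccontr)
      assume "\<not> n \<le> 1"
      then have n: "2 \<le> n" by simp
      define p where "p i = {r \<in> carrier R. fr r \<one> \<in> F i}" for i
      have p: "primeideal (p 0) R" "primeideal (p 1) R" "primeideal (p 2) R"
        unfolding p_def using F n by (auto intro!: contract_prime)
      have "p i \<subset> p (Suc i)" if "i < 2" for i unfolding p_def
        using F n that by (intro contract_strict) (auto simp: primeideal_def)
      then have lt: "p 0 \<subset> p 1" "p 1 \<subset> p 2" by (force simp: numeral_2_eq_2)+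
      interpret p1: primeideal "p 1" R by (rule p)
      interpret p2: primeideal "p 2" R by (rule p)
      obtain q where q: "q \<in> p 1" "q \<notin> p 0" using lt by blast
      obtain y where y: "y \<in> p 2" "y \<notin> p 1" using lt by blast
      \<comment> \<open>Since \<open>N\<close> lies in \<open>p 0\<close>, the element
        \<open>q\<close> separating \<open>p 0\<close> from \<open>p 1\<close> is subject to
        \<open>zdim\<close>. The identity puts a power of \<open>y\<close> times 1 - b*y into
        \<open>p 1\<close>; as \<open>y\<close> is not there, 1 - b*y is, and then 1 lies in
        \<open>p 2\<close>.\<close>
      have qN: "q \<notin> N" using N_sub[OF p(1)] q by blast
      obtain m b c where mbc: "b \<in> carrier R" "c \<in> carrier R"
        "(\<one> \<ominus> b \<otimes> y) \<otimes> y [^] (m::nat) = q \<otimes> c"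
        using zdim[OF _ qN, of y] q y p1.Icarr p2.Icarr by blast
      have yc: "y \<in> carrier R" using y p2.Icarr by blast
      have "(\<one> \<ominus> b \<otimes> y) \<otimes> y [^] m \<in> p 1" unfolding mbc(3) using q mbc by (intro p1.I_r_closed)
      moreover have "y [^] m \<in> p 1 \<Longrightarrow> y \<in> p 1" for m :: nat
      proof (induction m)
        case 0
        then show ?case using p1.one_imp_carrier p1.I_notcarr by auto
      next
        case (Suc m)
        then show ?case using p1.I_prime yc by (metis nat_pow_Suc nat_pow_closed)
      qed
      ultimately have "\<one> \<ominus> b \<otimes> y \<in> p 1"
        using p1.I_prime y yc mbc by (metis minus_closed m_closed nat_pow_closed one_closed)
      then have "\<one> \<ominus> b \<otimes> y \<oplus> b \<otimes> y \<in> p 2"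
        using lt y mbc p2.I_l_closed by (intro p2.a_closed) blast+
      moreover have "\<one> \<ominus> b \<otimes> y \<oplus> b \<otimes> y = \<one>" using yc mbc
        by (simp add: a_minus_def a_assoc l_neg)
      ultimately show False using p2.one_imp_carrier p2.I_notcarr by metis
    qed
    then have dim: "krull_dim L = 1" using dim_ge unfolding krull_dim_def
      by (intro antisym Sup_least) (auto simp: one_enat_def)

    have "regular_sequence L [fr x \<one>]"
    proof -
      have "fr x \<one> \<otimes>\<^bsub>L\<^esub> y \<in> Idl\<^bsub>L\<^esub> {} \<longrightarrow> y \<in> Idl\<^bsub>L\<^esub> {}" if y: "y \<in> carrier L" for y
      proof
        assume *: "fr x \<one> \<otimes>\<^bsub>L\<^esub> y \<in> Idl\<^bsub>L\<^esub> {}"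
        obtain r s where rs: "r \<in> carrier R" "s \<in> S" "y = fr r s" using y by (rule L_carrierE)
        have "fr (x \<otimes> r) s = \<zero>\<^bsub>L\<^esub>" using * rs xc S_one by (simp add: L.genideal_empty fr_mult)
        then obtain u where u: "u \<in> S" "u \<otimes> (x \<otimes> r) = \<zero>" using fr_zero_iff rs xc by blast
        \<comment> \<open>Denominators avoid \<open>M\<close> and hence \<open>N\<close>, so
          \<open>reg\<close> applies to \<open>u\<close> too: localizing kills nothing.\<close>
        have "x \<otimes> r = \<zero>" using reg[of u "x \<otimes> r"] u xc rs NS by blast
        then have "r = \<zero>" using reg[of x r] rs xc x by blast
        then have "y = \<zero>\<^bsub>L\<^esub>" unfolding rs(3) using rs S_one by (subst fr_zero_iff) auto
        then show "y \<in> Idl\<^bsub>L\<^esub> {}" by (simp add: L.genideal_empty)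
      qed
      moreover have "Idl\<^bsub>L\<^esub> {fr x \<one>} \<noteq> carrier L"
        using L.genideal_minimal[OF E.ideal_axioms, of "{fr x \<one>}"] xE E.I_notcarr E.Icarr by blast
      ultimately show ?thesis unfolding regular_sequence_singleton using xc S_one by blast
    qed
    then have depth_ge: "1 \<le> depth L E" unfolding depth_def
      using xE by (intro Sup_upper CollectI exI[of _ "[fr x \<one>]"]) (auto simp: one_enat_def)

    have depth_le: "length xs \<le> 1" if xs: "regular_sequence L xs" "set xs \<subseteq> E" for xs
    proof (rule ccontr)
      assume "\<not> length xs \<le> 1"
      then obtain x1 x2 ys where xs_eq: "xs = x1 # x2 # ys"
        by (metis One_nat_def Suc_le_mono le0 length_Cons list.exhaust list.size(3))
      have x1: "x1 \<in> E" and x2: "x2 \<in> E" using xs xs_eq by auto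
      have x1c: "x1 \<in> carrier L" and x2c: "x2 \<in> carrier L" using x1 x2 E.Icarr by auto
      have nz: "\<one>\<^bsub>L\<^esub> \<noteq> \<zero>\<^bsub>L\<^esub>" using E.zero_closed E.one_imp_carrier E.I_notcarr by metis
      have r1: "y = \<zero>\<^bsub>L\<^esub>" if "y \<in> carrier L" "x1 \<otimes>\<^bsub>L\<^esub> y = \<zero>\<^bsub>L\<^esub>" for y
        using regular_sequence_Cons_Cons(1)[OF xs(1)[unfolded xs_eq], of y] that
        by (simp add: L.genideal_empty)
      let ?I = "Idl\<^bsub>L\<^esub> {x1}"
      interpret I: ideal ?I L by (rule L.genideal_ideal) (use x1c in simp)
      have x1I: "x1 \<in> ?I" using L.genideal_self'[OF x1c] .
      have r2: "y \<in> ?I" if "y \<in> carrier L" "x2 \<otimes>\<^bsub>L\<^esub> y \<in> ?I" for y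
        by (rule regular_sequence_Cons_Cons(2)[OF xs(1)[unfolded xs_eq] that])
      obtain p s where ps: "p \<in> M" "s \<in> S" "x1 = fr p s" using x1 E_def by blast
      obtain q t where qt: "q \<in> M" "t \<in> S" "x2 = fr q t" using x2 E_def by blast
      have pc: "p \<in> carrier R" and qc: "q \<in> carrier R" using ps qt M.Icarr by auto
      \<comment> \<open>A regular element of a nonzero ring is not nilpotent. This makes
        \<open>zdim\<close> available for the numerator of \<open>x1\<close>.\<close>
      have pN: "p \<notin> N"
      proof
        assume "p \<in> N"
        then obtain n where n: "p [^] (n::nat) = \<zero>" using nil by blast
        have "x1 [^]\<^bsub>L\<^esub> n = fr (p [^] n) (s [^] n) \<and> s [^] n \<in> S"
          unfolding ps(3) using pc ps(2)
          by (induction n) (simp_all add: L_one S_one fr_mult S_mult)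
        then have "x1 [^]\<^bsub>L\<^esub> n = \<zero>\<^bsub>L\<^esub>" unfolding n using S_one by (auto simp: fr_zero_iff)
        moreover have "x1 [^]\<^bsub>L\<^esub> n = \<zero>\<^bsub>L\<^esub> \<Longrightarrow> False" for n :: nat
        proof (induction n)
          case (Suc n)
          then show ?case using r1[of "x1 [^]\<^bsub>L\<^esub> n"] x1c
            by (metis L.m_comm L.nat_pow_Suc L.nat_pow_closed)
        qed (use nz in simp)
        ultimately show False by blast
      qed
      obtain m b c where mbc: "b \<in> carrier R" "c \<in> carrier R"
        "(\<one> \<ominus> b \<otimes> q) \<otimes> q [^] (m::nat) = p \<otimes> c"
        using zdim[OF pc pN qc] by blast
      define v where "v = \<one> \<ominus> b \<otimes> q"
      have vc: "v \<in> carrier R" unfolding v_def using mbc qc by blast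
      \<comment> \<open>As \<open>q\<close> lies in \<open>M\<close>, the factor 1 - b*q becomes a
        unit in the localization, and the identity from \<open>zdim\<close> places a power of
        \<open>q\<close> in the ideal generated by \<open>x1\<close>.\<close>
      have "v \<notin> M"
      proof
        assume "v \<in> M"
        then have "\<one> \<ominus> b \<otimes> q \<oplus> b \<otimes> q \<in> M" unfolding v_def
          using qt mbc M.I_l_closed by (intro M.a_closed) blast+
        moreover have "\<one> \<ominus> b \<otimes> q \<oplus> b \<otimes> q = \<one>" using qc mbc by (simp add: a_minus_def a_assoc l_neg)
        ultimately show False using one_M by simp
      qed
      then have v: "v \<in> S" unfolding S_def using vc by simp
      have "fr (q [^] m) \<one> = x1 \<otimes>\<^bsub>L\<^esub> fr (s \<otimes> c) v"
      proof -
        have "x1 \<otimes>\<^bsub>L\<^esub> fr (s \<otimes> c) v = fr (s \<otimes> (p \<otimes> c)) (s \<otimes> v)"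
          unfolding ps(3) using pc ps v mbc by (simp add: fr_mult m_ac)
        also have "\<dots> = fr (p \<otimes> c) v" using pc ps v mbc by (intro fr_cancel) auto
        also have "\<dots> = fr (v \<otimes> q [^] m) (v \<otimes> \<one>)" using mbc(3) v unfolding v_def by simp
        also have "\<dots> = fr (q [^] m) \<one>" using qc v S_one by (intro fr_cancel) auto
        finally show ?thesis ..
      qed
      also have "\<dots> \<in> ?I" using x1I ps mbc v by (intro I.I_r_closed) auto
      finally have qm: "fr (q [^] m) \<one> \<in> ?I" .
      \<comment> \<open>Regularity of \<open>x2\<close> modulo \<open>x1\<close> strips off the
        factors \<open>q\<close> one at a time until 1 is left, contradicting properness.\<close>
      have "fr (q [^] m) \<one> \<in> ?I \<Longrightarrow> \<one>\<^bsub>L\<^esub> \<in> ?I" for m :: nat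
      proof (induction m)
        case (Suc m)
        have "x2 \<otimes>\<^bsub>L\<^esub> fr (q [^] m) \<one> = fr \<one> t \<otimes>\<^bsub>L\<^esub> fr (q [^] Suc m) \<one>"
          unfolding qt(3) using qc qt S_one by (simp add: fr_mult m_ac)
        also have "\<dots> \<in> ?I" using Suc.prems qt by (intro I.I_l_closed) auto
        finally have *: "x2 \<otimes>\<^bsub>L\<^esub> fr (q [^] m) \<one> \<in> ?I" .
        have "fr (q [^] m) \<one> \<in> ?I" by (rule r2[OF fr_carrier[OF nat_pow_closed[OF qc] S_one] *])
        then show ?case by (rule Suc.IH)
      qed (simp add: L_one)
      from this[OF qm] have "?I = carrier L" by (rule I.one_imp_carrier)
      moreover have xsc: "set xs \<subseteq> carrier L" using xs(2) E.Icarr by (rule order_trans[OF _ subsetI])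
      then have "?I \<subseteq> Idl\<^bsub>L\<^esub> (set xs)" unfolding xs_eq by (intro L.subset_Idl_subset) simp_all
      moreover have "Idl\<^bsub>L\<^esub> (set xs) \<subseteq> carrier L" by (rule L.genideal_minimal[OF L.oneideal xsc])
      moreover have "Idl\<^bsub>L\<^esub> (set xs) \<noteq> carrier L" using xs(1) unfolding regular_sequence_def by (elim conjE)
      ultimately show False by (metis subset_antisym)
    qed
    then have depth: "depth L E = 1" using depth_ge unfolding depth_def
      by (intro antisym Sup_least) (auto simp: one_enat_def)
    have "\<forall>M'. maximalideal M' L \<longleftrightarrow> M' = E"
      unfolding E_def using maximal_iff_extension[OF S_def Mp] by blast
    then show "Cohen_Macaulay_local (localization R (carrier R - M))"
      unfolding Cohen_Macaulay_local_def S_def[symmetric]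
      using L_cring L_noetherian[OF noetherian_ring_axioms] depth dim by metis
  qed
qed

section \<open>Powers of monomial ideals\<close>

text \<open>One wrapper serves both \<open>A\<close>, inside the power series over k, and the Rees
  ring, inside the power series over k[T]; calculations then take place in the ambient type-class
  ring.\<close>

definition ring_on :: "'a::comm_ring_1 set \<Rightarrow> 'a ring" where
  "ring_on C = \<lparr>carrier = C, monoid.mult = (*), one = 1, ring.zero = 0, add = (+)\<rparr>"

lemma ring_on_simps [simp]:
  "carrier (ring_on C) = C" "x \<otimes>\<^bsub>ring_on C\<^esub> y = x * y" "\<one>\<^bsub>ring_on C\<^esub> = 1"
  "\<zero>\<^bsub>ring_on C\<^esub> = 0" "x \<oplus>\<^bsub>ring_on C\<^esub> y = x + y"
  unfolding ring_on_def by simp_all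

locale unital_subring =
  fixes C :: "'a::comm_ring_1 set"
  assumes one_mem: "1 \<in> C" and add_mem: "\<lbrakk>x \<in> C; y \<in> C\<rbrakk> \<Longrightarrow> x + y \<in> C"
    and uminus_mem: "x \<in> C \<Longrightarrow> - x \<in> C" and mult_mem: "\<lbrakk>x \<in> C; y \<in> C\<rbrakk> \<Longrightarrow> x * y \<in> C"
begin

lemma zero_mem: "0 \<in> C"
  using add_mem[OF one_mem uminus_mem[OF one_mem]] by simp

lemma diff_mem: "\<lbrakk>x \<in> C; y \<in> C\<rbrakk> \<Longrightarrow> x - y \<in> C"
  using add_mem[OF _ uminus_mem] by fastforce

lemma power_mem: "x \<in> C \<Longrightarrow> x ^ n \<in> C"
  by (induction n) (auto intro: one_mem mult_mem)

lemma cring: "cring (ring_on C)"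
proof (rule cringI)
  show "abelian_group (ring_on C)"
    by (rule abelian_groupI) (auto simp: zero_mem add_mem algebra_simps intro!: bexI[OF _ uminus_mem])
  show "comm_monoid (ring_on C)"
    by (rule comm_monoidI) (auto simp: one_mem mult_mem algebra_simps)
qed (simp add: algebra_simps)

lemma finsum_eq_sum: "f ` A \<subseteq> C \<Longrightarrow> finite A \<Longrightarrow> finsum (ring_on C) f A = sum f A"
proof -
  interpret cring "ring_on C" by (rule cring)
  show "f ` A \<subseteq> C \<Longrightarrow> finite A \<Longrightarrow> finsum (ring_on C) f A = sum f A"
  proof (induction A rule: infinite_finite_induct)
    case (insert x F)
    then show ?case by (subst finsum_insert) auto
  qed simp_all
qed

lemma a_inv_eq: "x \<in> C \<Longrightarrow> \<ominus>\<^bsub>ring_on C\<^esub> x = - x"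
proof -
  interpret cring "ring_on C" by (rule cring)
  assume "x \<in> C"
  then show "\<ominus>\<^bsub>ring_on C\<^esub> x = - x" by (intro minus_equality) (simp_all add: uminus_mem)
qed

lemma ideal_iff:
  "ideal J (ring_on C) \<longleftrightarrow> J \<subseteq> C \<and> 0 \<in> J \<and> (\<forall>x\<in>J. \<forall>y\<in>J. x + y \<in> J) \<and>
     (\<forall>x\<in>J. \<forall>c\<in>C. c * x \<in> J)" (is "_ \<longleftrightarrow> ?R")
proof
  interpret cring "ring_on C" by (rule cring)
  show "?R" if "ideal J (ring_on C)"
  proof -
    interpret J: ideal J "ring_on C" by fact
    show ?R using J.Icarr J.zero_closed J.a_closed J.I_l_closed by auto
  qed
  assume R: ?R
  show "ideal J (ring_on C)"
  proof (rule idealI)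
    show "subgroup J (add_monoid (ring_on C))"
    proof (rule add.subgroupI)
      fix x assume x: "x \<in> J"
      have "(- 1) * x \<in> J" using R x uminus_mem[OF one_mem] by blast
      then show "\<ominus>\<^bsub>ring_on C\<^esub> x \<in> J" using a_inv_eq[of x] R x by auto
    next
      show "J \<noteq> {}" using R by blast
    qed (use R in simp_all)
    fix x c assume "x \<in> J" "c \<in> carrier (ring_on C)"
    then have "c * x \<in> J" using R by simp
    then show "c \<otimes>\<^bsub>ring_on C\<^esub> x \<in> J" "x \<otimes>\<^bsub>ring_on C\<^esub> c \<in> J" by (simp_all add: mult.commute[of x])
  qed (rule ring_axioms)
qed

end

unbundle fps_syntax

section \<open>Power series with exponents in a prescribed set\<close>

definition supported :: "nat set \<Rightarrow> 'k::comm_ring_1 fps set" where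
  "supported T = {f. \<forall>n. f $ n \<noteq> 0 \<longrightarrow> n \<in> T}"

lemma supportedI: "(\<And>n. f $ n \<noteq> 0 \<Longrightarrow> n \<in> T) \<Longrightarrow> f \<in> supported T"
  and supportedD: "f \<in> supported T \<Longrightarrow> f $ n \<noteq> 0 \<Longrightarrow> n \<in> T"
  unfolding supported_def by auto

lemma supported_mono: "T \<subseteq> Y \<Longrightarrow> supported T \<subseteq> supported Y"
  unfolding supported_def by blast

lemma supported_iff: "f \<in> supported T \<longleftrightarrow> (\<forall>n. n \<notin> T \<longrightarrow> f $ n = 0)"
  unfolding supported_def by blast

lemma supported_zero [simp]: "0 \<in> supported T"
  by (simp add: supported_def)

lemma supported_uminus: "f \<in> supported T \<Longrightarrow> - f \<in> supported T"
  and supported_add: "f \<in> supported T \<Longrightarrow> g \<in> supported T \<Longrightarrow> f + g \<in> supported T"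
  and supported_diff: "f \<in> supported T \<Longrightarrow> g \<in> supported T \<Longrightarrow> f - g \<in> supported T"
  by (simp_all add: supported_iff)

lemma supported_sum: "(\<And>i. i \<in> A \<Longrightarrow> f i \<in> supported T) \<Longrightarrow> sum f A \<in> supported T"
  by (induction A rule: infinite_finite_induct) (simp_all add: supported_add)

lemma supported_mult:
  assumes "f \<in> supported T" "g \<in> supported Y" "\<And>x y. x \<in> T \<Longrightarrow> y \<in> Y \<Longrightarrow> x + y \<in> Z"
  shows "f * g \<in> supported Z"
proof (rule supportedI)
  fix n assume "(f * g) $ n \<noteq> 0"
  then obtain i where "i \<le> n" "f $ i * g $ (n - i) \<noteq> 0"
    unfolding fps_mult_nth by (metis (no_types, lifting) atLeastAtMost_iff sum.neutral)
  then have "i \<in> T" "n - i \<in> Y" using assms supportedD by (metis mult_zero_left mult_zero_right)+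
  then show "n \<in> Z" using assms(3)[of i "n - i"] \<open>i \<le> n\<close> by simp
qed

lemma supported_X_power: "n \<in> T \<Longrightarrow> fps_X ^ n \<in> supported T"
  by (auto simp: supported_iff)

text \<open>Each exponent n of \<open>f\<close> is assigned one summand \<open>\<sigma> n\<close> in
  \<open>W\<close>, and \<open>g w\<close> collects the terms assigned to \<open>w\<close>, shifted
  down. A series with infinitely many terms thus becomes a finite sum of products, as membership in
  an ideal product demands.\<close>

lemma supported_sumset_decomp:
  fixes f :: "'k::comm_ring_1 fps"
  assumes "finite W" "f \<in> supported {w + u | w u. w \<in> W \<and> u \<in> U}"
  obtains g where "\<And>w. w \<in> W \<Longrightarrow> g w \<in> supported U" "f = (\<Sum>w\<in>W. fps_X ^ w * g w)"
proof -
  have "\<forall>n. \<exists>w. f $ n \<noteq> 0 \<longrightarrow> w \<in> W \<and> w \<le> n \<and> n - w \<in> U"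
    using supportedD[OF assms(2)] by force
  then obtain \<sigma> where \<sigma>: "\<And>n. f $ n \<noteq> 0 \<Longrightarrow> \<sigma> n \<in> W \<and> \<sigma> n \<le> n \<and> n - \<sigma> n \<in> U" by metis
  define g where "g w = Abs_fps (\<lambda>m. if \<sigma> (m + w) = w then f $ (m + w) else 0)" for w
  have g: "g w \<in> supported U" for w
  proof (rule supportedI)
    fix m assume "g w $ m \<noteq> 0"
    then have "\<sigma> (m + w) = w" "f $ (m + w) \<noteq> 0" by (auto simp: g_def split: if_splits)
    then show "m \<in> U" using \<sigma>[of "m + w"] by simp
  qed
  have "(\<Sum>w\<in>W. fps_X ^ w * g w) $ n = f $ n" for n
  proof -
    have "(\<Sum>w\<in>W. fps_X ^ w * g w) $ n = (\<Sum>w\<in>W. if w = \<sigma> n then f $ n else 0)"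
      unfolding fps_sum_nth
      using \<sigma>[of n] by (cases "f $ n = 0") (auto simp: fps_X_power_mult_nth g_def intro!: sum.cong)
    also have "\<dots> = f $ n" using assms(1) \<sigma>[of n] by (cases "f $ n = 0") (simp_all add: sum.delta)
    finally show ?thesis .
  qed
  then have "f = (\<Sum>w\<in>W. fps_X ^ w * g w)" by (intro fps_ext) simp
  with g show thesis by (rule that)
qed

section \<open>Ideals of semigroup rings given by a lower bound on the exponents, and their
  powers\<close>

locale numerical_semigroup_ideal =
  fixes H :: "nat set" and s c :: nat
  assumes H_zero: "0 \<in> H" and H_add: "\<lbrakk>x \<in> H; y \<in> H\<rbrakk> \<Longrightarrow> x + y \<in> H"
    and H_conductor: "c \<le> x \<Longrightarrow> x \<in> H" and s_mem: "s \<in> H" and s_pos: "0 < s"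
begin

primrec E :: "nat \<Rightarrow> nat set" where
  "E 0 = H"
| "E (Suc n) = {x + y | x y. x \<in> E n \<and> y \<in> H \<and> s \<le> y}"

lemma E_SucI: "\<lbrakk>x \<in> E n; y \<in> H; s \<le> y\<rbrakk> \<Longrightarrow> x + y \<in> E (Suc n)"
  by auto

lemma E_add_H: "x \<in> E n \<Longrightarrow> h \<in> H \<Longrightarrow> x + h \<in> E n"
proof (induction n arbitrary: x)
  case (Suc n)
  then obtain x' y where "x = x' + y" "x' \<in> E n" "y \<in> H" "s \<le> y" by auto
  then show ?case using E_SucI[of x' n "y + h"] H_add Suc.prems by (simp add: add.assoc)
qed (simp add: H_add)

lemma E_add: "x \<in> E i \<Longrightarrow> y \<in> E j \<Longrightarrow> x + y \<in> E (i + j)"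
proof (induction j arbitrary: y)
  case (Suc j)
  then obtain y' h where "y = y' + h" "y' \<in> E j" "h \<in> H" "s \<le> h" by auto
  then show ?case using E_SucI[of "x + y'" "i + j" h] Suc by (simp add: add.assoc)
qed (simp add: E_add_H)

lemma E_Suc_subset: "E (Suc n) \<subseteq> E n"
  using E_add_H by auto

lemma E_antimono: "m \<le> n \<Longrightarrow> E n \<subseteq> E m"
  by (rule lift_Suc_antimono_le[of E, OF E_Suc_subset])

lemma E_subset_H: "E n \<subseteq> H"
  using E_antimono[of 0 n] by simp

lemma E_lower: "e \<in> E n \<Longrightarrow> n * s \<le> e"
proof (induction n arbitrary: e)
  case (Suc n)
  then obtain x y where "e = x + y" "x \<in> E n" "s \<le> y" by auto
  then show ?case using Suc.IH[of x] by simp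
qed simp

lemma mult_s_mem_E: "n * s \<in> E n"
proof (induction n)
  case (Suc n)
  then show ?case using E_SucI[OF Suc s_mem] by (simp add: add.commute)
qed (simp add: H_zero)

lemma E_upper: "n * s + c \<le> e \<Longrightarrow> e \<in> E n"
  using E_add_H[OF mult_s_mem_E, of "e - n * s" n] H_conductor by simp

lemma E_1: "E 1 = {h \<in> H. s \<le> h}"
proof (intro Set.set_eqI iffI)
  fix h assume "h \<in> {h \<in> H. s \<le> h}"
  then show "h \<in> E 1" using E_SucI[of 0 0 h] H_zero by simp
qed (auto intro: H_add)

definition A :: "'k::field fps ring" where "A = ring_on (supported H)"
definition I :: "'k::field fps set" where "I = supported (E 1)"

sublocale A: unital_subring "supported H :: 'k::field fps set"
proof
  show "1 \<in> supported H" using supported_X_power[OF H_zero] by simp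
  show "x * y \<in> supported H" if "x \<in> supported H" "y \<in> supported H" for x y :: "'k fps"
    using that H_add by (rule supported_mult)
qed (simp_all add: supported_add supported_uminus)

lemma ideal_supported_E: "ideal (supported (E n) :: 'k::field fps set) A"
proof -
  have "f * x \<in> supported (E n)" if "f \<in> supported H" "x \<in> supported (E n)" for f x :: "'k fps"
    using supported_mult[OF that(2,1) E_add_H] by (simp only: mult.commute)
  then show ?thesis unfolding A_def A.ideal_iff
    using supported_mono[OF E_subset_H[of n]] supported_add by (metis supported_zero)
qed

text \<open>Finitely many exponents of \<open>I\<close> suffice as factors: if y >= s + c, then x +
  y = s + (x + (y - s)), where y - s is beyond the conductor and can be absorbed into the element of
  \<open>E n\<close>.\<close>

lemma supported_E_Suc_subset:
  "(supported (E (Suc n)) :: 'k::field fps set) \<subseteq> ideal_prod A (supported (E n)) I"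
proof
  fix f :: "'k fps" assume f: "f \<in> supported (E (Suc n))"
  \<comment> \<open>For c = 0 the range is empty, so \<open>s\<close> is inserted
    explicitly.\<close>
  define W where "W = insert s {h \<in> H. s \<le> h \<and> h < s + c}"
  have W: "finite W" "W \<subseteq> E 1" unfolding W_def E_1 using s_mem by auto
  have "E (Suc n) \<subseteq> {w + u | w u. w \<in> W \<and> u \<in> E n}"
  proof
    fix e assume "e \<in> E (Suc n)"
    then obtain x y where xy: "e = x + y" "x \<in> E n" "y \<in> H" "s \<le> y" by auto
    show "e \<in> {w + u | w u. w \<in> W \<and> u \<in> E n}"
    proof (cases "y < s + c")
      case True
      then have "y \<in> W" using xy W_def by simp
      then show ?thesis using xy add.commute by blast
    next
      case False
      then have "x + (y - s) \<in> E n" using xy by (intro E_add_H H_conductor) auto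
      moreover have "e = s + (x + (y - s))" "s \<in> W" using xy W_def by auto
      ultimately show ?thesis by blast
    qed
  qed
  then have "f \<in> supported {w + u | w u. w \<in> W \<and> u \<in> E n}" using f supported_mono by blast
  then obtain g where g: "\<And>w. w \<in> W \<Longrightarrow> g w \<in> supported (E n)" "f = (\<Sum>w\<in>W. fps_X ^ w * g w)"
    using supported_sumset_decomp[OF W(1)] by blast
  let ?P = "ideal_prod A (supported (E n)) I"
  have 0: "0 \<in> ?P" using ideal_prod.prod[of 0 "supported (E n)" 0 I A] by (simp add: A_def I_def)
  have "(\<Sum>w\<in>V. fps_X ^ w * g w) \<in> ?P" if "finite V" "V \<subseteq> W" for V using that
  proof (induction V rule: finite_induct)
    case (insert w V)
    have "fps_X ^ w \<in> I" using insert W unfolding I_def by (intro supported_X_power) blast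
    then have "fps_X ^ w * g w \<in> ?P"
      using ideal_prod.prod[OF g(1)[of w], of "fps_X ^ w" I A] insert
      by (simp add: A_def mult.commute)
    then show ?case using ideal_prod.sum[of _ A "supported (E n)" I] insert by (simp add: A_def)
  qed (simp add: 0)
  then show "f \<in> ?P" using g(2) W(1) by blast
qed

lemma ideal_pow_eq: "ideal_pow A I n = (supported (E n) :: 'k::field fps set)"
proof (induction n)
  case 0
  show ?case by (simp only: ideal_pow.simps E.simps A_def ring_on_simps)
next
  case (Suc n)
  have "x \<in> supported (E (Suc n))" if "x \<in> ideal_prod A (supported (E n)) I" for x :: "'k fps"
    using that
  proof (induction rule: ideal_prod.induct)
    case (prod i j)
    then have "i * j \<in> supported (E (n + 1))"
      unfolding I_def by (intro supported_mult[OF _ _ E_add])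
    then show ?case by (simp only: A_def ring_on_simps Suc_eq_plus1)
  next
    case (sum s1 s2)
    then show ?case unfolding A_def by (simp only: ring_on_simps supported_add)
  qed
  then show ?case using supported_E_Suc_subset[of n] by (simp only: ideal_pow.simps Suc) blast
qed

end

section \<open>The associated graded ring as a quotient of the Rees algebra\<close>

context numerical_semigroup_ideal
begin

text \<open>
  The Rees ring $\bigoplus_n I^n$ is modelled inside $k[T][[X]]$: the monomial $T^n X^d$ stands for
  $t^{ns+d}$ in degree $n$. This is possible because $I^n \subseteq t^{ns} k[[t]]$, and it makes
  the constant term in $X$ the surjection onto $k[T]$.
\<close>

definition rees :: "'k::field poly fps set" where
  "rees = {P. (\<forall>d n. coeff (P $ d) n \<noteq> 0 \<longrightarrow> n * s + d \<in> E n) \<and> (\<exists>D. \<forall>d. degree (P $ d) \<le> D)}"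

text \<open>The component of degree n as an actual element of k[[t]]: the factor
  \<open>fps_X ^ (n * s)\<close> undoes the shift built into \<open>rees\<close>.\<close>

definition row :: "'k::field poly fps \<Rightarrow> nat \<Rightarrow> 'k fps" where
  "row P n = fps_X ^ (n * s) * Abs_fps (\<lambda>d. coeff (P $ d) n)"

definition coset :: "nat \<Rightarrow> 'k::field fps \<Rightarrow> 'k fps set" where
  "coset n f = {y. y - f \<in> supported (E (Suc n))}"

definition proj :: "'k::field poly fps \<Rightarrow> nat \<Rightarrow> 'k fps set" where
  "proj P n = coset n (row P n)"

definition G :: "(nat \<Rightarrow> 'k::field fps set) ring" where
  "G = assoc_graded A I"

lemma reesI:
  "(\<And>d n. coeff (P $ d) n \<noteq> 0 \<Longrightarrow> n * s + d \<in> E n) \<Longrightarrow> (\<And>d. degree (P $ d) \<le> D) \<Longrightarrow> P \<in> rees"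
  unfolding rees_def by blast

lemma reesD: "P \<in> rees \<Longrightarrow> coeff (P $ d) n \<noteq> 0 \<Longrightarrow> n * s + d \<in> E n"
  unfolding rees_def by blast

text \<open>The bound is uniform in d because an element of the direct sum has finitely many degrees
  n, although d runs through infinitely many exponents.\<close>

lemma rees_degree_bound: "P \<in> rees \<Longrightarrow> \<exists>D. \<forall>d. degree (P $ d) \<le> D"
  unfolding rees_def by blast

sublocale rees: unital_subring "rees :: 'k::field poly fps set"
proof
  show "1 \<in> (rees :: 'k poly fps set)"
    by (rule reesI[of _ 0]) (auto split: if_splits simp: H_zero)
next
  fix P Q :: "'k poly fps" assume PQ: "P \<in> rees" "Q \<in> rees"
  obtain D where D: "\<And>d. degree (P $ d) \<le> D" using rees_degree_bound[OF PQ(1)] by (auto elim: exE)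
  obtain D' where D': "\<And>d. degree (Q $ d) \<le> D'" using rees_degree_bound[OF PQ(2)] by (auto elim: exE)
  show "P + Q \<in> rees"
  proof (rule reesI[of _ "max D D'"])
    show "n * s + d \<in> E n" if "coeff ((P + Q) $ d) n \<noteq> 0" for d n
      using that reesD[OF PQ(1), of d n] reesD[OF PQ(2), of d n] by fastforce
    show "degree ((P + Q) $ d) \<le> max D D'" for d
      using D[of d] D'[of d] degree_add_le_max[of "P $ d" "Q $ d"] by simp
  qed
  show "P * Q \<in> rees"
  proof (rule reesI[of _ "D + D'"])
    fix d n assume "coeff ((P * Q) $ d) n \<noteq> 0"
    then obtain j where j: "j \<le> d" "coeff (P $ j * Q $ (d - j)) n \<noteq> 0"
      unfolding fps_mult_nth coeff_sum by (metis (no_types, lifting) atLeastAtMost_iff sum.neutral)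
    then obtain i where i: "i \<le> n" "coeff (P $ j) i * coeff (Q $ (d - j)) (n - i) \<noteq> 0"
      unfolding coeff_mult by (metis (no_types, lifting) atMost_iff sum.neutral)
    then have "i * s + j \<in> E i" "(n - i) * s + (d - j) \<in> E (n - i)"
      using reesD PQ by auto
    then have "i * s + j + ((n - i) * s + (d - j)) \<in> E (i + (n - i))" by (rule E_add)
    moreover have "i * s + j + ((n - i) * s + (d - j)) = (i + (n - i)) * s + d"
      using j(1) by (simp only: distrib_right)
    ultimately show "n * s + d \<in> E n" using i(1) by simp
  next
    fix d
    have "degree (P $ j * Q $ (d - j)) \<le> D + D'" for j
      using degree_mult_le[of "P $ j" "Q $ (d - j)"] D[of j] D'[of "d - j"]
      by (meson add_mono le_trans)
    then show "degree ((P * Q) $ d) \<le> D + D'"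
      unfolding fps_mult_nth by (intro degree_sum_le) auto
  qed
next
  fix P :: "'k poly fps" assume "P \<in> rees"
  then show "- P \<in> rees" unfolding rees_def by simp
qed

lemma row_nth: "row P n $ e = (if e < n * s then 0 else coeff (P $ (e - n * s)) n)"
  unfolding row_def by (simp add: fps_X_power_mult_nth)

lemma row_add: "row (P + Q) n = row P n + row Q n"
  and row_diff: "row (P - Q) n = row P n - row Q n"
  by (rule fps_ext, simp add: row_nth)+

lemma row_mult: "row (P * Q) n = (\<Sum>i\<le>n. row P i * row Q (n - i))"
proof -
  let ?r = "\<lambda>P n. Abs_fps (\<lambda>d. coeff (P $ d) n)"
  have "?r (P * Q) n = (\<Sum>i\<le>n. ?r P i * ?r Q (n - i))"
    by (rule fps_ext) (simp add: fps_mult_nth fps_sum_nth coeff_sum coeff_mult, rule sum.swap)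
  moreover have "fps_X ^ (n * s) * (?r P i * ?r Q (n - i)) = row P i * row Q (n - i)" if "i \<le> n" for i
  proof -
    have "(fps_X :: 'a fps) ^ (n * s) = fps_X ^ (i * s) * fps_X ^ ((n - i) * s)"
      using that by (simp flip: power_add distrib_right)
    then show ?thesis unfolding row_def by (simp only: ac_simps)
  qed
  ultimately show ?thesis unfolding row_def[of "P * Q"] by (simp add: sum_distrib_left)
qed

lemma row_zero: "row 0 n = 0"
  by (rule fps_ext) (simp add: row_nth)

lemma row_one: "row 1 n = (if n = 0 then 1 else 0)"
  by (rule fps_ext) (auto simp: row_nth)

lemma row_supported: "P \<in> rees \<Longrightarrow> row P n \<in> supported (E n)"
  by (rule supportedI) (use reesD in \<open>fastforce simp: row_nth split: if_splits\<close>)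

lemma row_supported_iff:
  "row P n \<in> supported (E m) \<longleftrightarrow> (\<forall>d. coeff (P $ d) n \<noteq> 0 \<longrightarrow> n * s + d \<in> E m)"
proof
  assume *: "row P n \<in> supported (E m)"
  show "\<forall>d. coeff (P $ d) n \<noteq> 0 \<longrightarrow> n * s + d \<in> E m"
    using supportedD[OF *, of "n * s + _"] by (simp add: row_nth)
next
  assume *: "\<forall>d. coeff (P $ d) n \<noteq> 0 \<longrightarrow> n * s + d \<in> E m"
  show "row P n \<in> supported (E m)"
    by (rule supportedI) (use * in \<open>fastforce simp: row_nth split: if_splits\<close>)
qed

lemma a_r_coset_eq: "supported (E (Suc n)) +>\<^bsub>A\<^esub> f = coset n f"
proof -
  have "y \<in> (\<Union>h\<in>supported (E (Suc n)). {h + f}) \<longleftrightarrow> y - f \<in> supported (E (Suc n))" for y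
    by (auto simp del: E.simps intro: bexI[of _ "y - f"])
  then show ?thesis unfolding a_r_coset_def' A_def coset_def by (simp del: E.simps) blast
qed

lemma coset_self: "f \<in> coset n f"
  unfolding coset_def by simp

lemma coset_eq_iff: "coset n f = coset n g \<longleftrightarrow> f - g \<in> supported (E (Suc n))"
proof
  assume "coset n f = coset n g"
  then show "f - g \<in> supported (E (Suc n))" using coset_self[of f n] unfolding coset_def by blast
next
  assume fg: "f - g \<in> supported (E (Suc n))"
  have "y - f \<in> supported (E (Suc n)) \<longleftrightarrow> y - g \<in> supported (E (Suc n))" for y
    using supported_add[OF _ fg, of "y - f"] supported_diff[OF _ fg, of "y - g"] by auto
  then show "coset n f = coset n g" unfolding coset_def by blast
qed

lemma coset_zero: "coset n 0 = supported (E (Suc n))"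
  unfolding coset_def by simp

lemma supported_E_mult: "f \<in> supported (E i) \<Longrightarrow> g \<in> supported (E j) \<Longrightarrow> f * g \<in> supported (E (i + j))"
  by (rule supported_mult[OF _ _ E_add])

lemma coset_supported: "f \<in> supported (E n) \<Longrightarrow> y \<in> coset n f \<Longrightarrow> y \<in> supported (E n)"
  using supported_mono[OF E_Suc_subset, of n] supported_add[of "y - f" "E n" f]
  unfolding coset_def by auto

lemma G_carrier:
  "carrier G = {g :: nat \<Rightarrow> 'k::field fps set.
     (\<forall>n. g n \<in> coset n ` supported (E n)) \<and> finite {n. g n \<noteq> coset n 0}}"
proof -
  have *: "(+>\<^bsub>A\<^esub>) (supported (E (Suc n))) = (coset n :: 'k fps \<Rightarrow> 'k fps set)" for n
    by (rule ext) (rule a_r_coset_eq)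
  show ?thesis
    unfolding G_def assoc_graded_def
    by (simp only: ideal_pow_eq * coset_zero partial_object.simps)
qed

lemma G_simps:
  "(g \<otimes>\<^bsub>G\<^esub> h) n = \<Union>{coset n (\<Oplus>\<^bsub>A\<^esub>i\<in>{..n}. x i \<otimes>\<^bsub>A\<^esub> y (n - i)) |
      x y. \<forall>i\<le>n. x i \<in> g i \<and> y i \<in> h i}"
  "\<one>\<^bsub>G\<^esub> n = coset n (if n = 0 then \<one>\<^bsub>A\<^esub> else \<zero>\<^bsub>A\<^esub>)"
  "\<zero>\<^bsub>G\<^esub> n = coset n 0" "(g \<oplus>\<^bsub>G\<^esub> h) n = g n <+>\<^bsub>A\<^esub> h n"
  unfolding G_def assoc_graded_def
  by (simp_all only: ideal_pow_eq a_r_coset_eq coset_zero ring.simps monoid.simps partial_object.simps)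

text \<open>Changing a factor of degree i by an element of the next power of the ideal changes a
  product of total degree n only within \<open>E (Suc n)\<close>, so the union over representatives
  is the single coset of the Rees product.\<close>

lemma proj_mult:
  assumes "P \<in> rees" "Q \<in> rees"
  shows "proj (P * Q) = proj P \<otimes>\<^bsub>G\<^esub> proj Q"
proof
  fix n
  have *: "coset n (\<Oplus>\<^bsub>A\<^esub>i\<in>{..n}. x i \<otimes>\<^bsub>A\<^esub> y (n - i)) = proj (P * Q) n"
    if "\<forall>i\<le>n. x i \<in> proj P i \<and> y i \<in> proj Q i" for x y
  proof -
    have x: "x i - row P i \<in> supported (E (Suc i))" "x i \<in> supported (E i)" if "i \<le> n" for i
      using \<open>\<forall>i\<le>n. _ i\<close> that coset_supported[OF row_supported[OF assms(1)]]
      unfolding proj_def coset_def by auto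
    have y: "y i - row Q i \<in> supported (E (Suc i))" "y i \<in> supported (E i)" if "i \<le> n" for i
      using \<open>\<forall>i\<le>n. _ i\<close> that coset_supported[OF row_supported[OF assms(2)]]
      unfolding proj_def coset_def by auto
    have H: "supported (E i) \<subseteq> (supported H :: 'a fps set)" for i
      by (rule supported_mono[OF E_subset_H])
    have "(\<Oplus>\<^bsub>A\<^esub>i\<in>{..n}. x i \<otimes>\<^bsub>A\<^esub> y (n - i)) = (\<Sum>i\<le>n. x i * y (n - i))"
      unfolding A_def ring_on_simps
      using H[THEN subsetD, OF x(2)] H[THEN subsetD, OF y(2)]
      by (intro A.finsum_eq_sum) (auto intro!: A.mult_mem)
    \<comment> \<open>The splitting x*y - p*q = (x - p)*y + p*(y - q) puts one small factor into
      each summand.\<close>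
    also have "\<dots> - row (P * Q) n = (\<Sum>i\<le>n. (x i - row P i) * y (n - i) + row P i * (y (n - i) - row Q (n - i)))"
      unfolding row_mult by (simp add: sum_subtractf[symmetric] algebra_simps)
    also have "\<dots> \<in> supported (E (Suc n))"
    proof (intro supported_sum supported_add)
      fix i assume "i \<in> {..n}"
      then have i: "i \<le> n" "Suc i + (n - i) = Suc n" "i + Suc (n - i) = Suc n" by auto
      show "(x i - row P i) * y (n - i) \<in> supported (E (Suc n))"
        using supported_E_mult[OF x(1)[OF i(1)] y(2)[of "n - i"]] i(2) by simp
      show "row P i * (y (n - i) - row Q (n - i)) \<in> supported (E (Suc n))"
        using supported_E_mult[OF row_supported[OF assms(1), of i] y(1)[of "n - i"]] i(3) by simp
    qed
    finally show ?thesis unfolding proj_def coset_eq_iff .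
  qed
  have "\<forall>i\<le>n. row P i \<in> proj P i \<and> row Q i \<in> proj Q i" unfolding proj_def using coset_self by blast
  then have **: "{coset n (\<Oplus>\<^bsub>A\<^esub>i\<in>{..n}. x i \<otimes>\<^bsub>A\<^esub> y (n - i)) |
      x y. \<forall>i\<le>n. x i \<in> proj P i \<and> y i \<in> proj Q i} = {proj (P * Q) n}"
    using * by blast
  have "(proj P \<otimes>\<^bsub>G\<^esub> proj Q) n = \<Union>{coset n (\<Oplus>\<^bsub>A\<^esub>i\<in>{..n}. x i \<otimes>\<^bsub>A\<^esub> y (n - i)) |
      x y. \<forall>i\<le>n. x i \<in> proj P i \<and> y i \<in> proj Q i}" by (rule G_simps(1))
  also have "\<dots> = proj (P * Q) n" unfolding ** by simp
  finally show "proj (P * Q) n = (proj P \<otimes>\<^bsub>G\<^esub> proj Q) n" ..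
qed

lemma proj_add: "P \<in> rees \<Longrightarrow> Q \<in> rees \<Longrightarrow> proj (P + Q) = proj P \<oplus>\<^bsub>G\<^esub> proj Q"
proof
  fix n
  interpret J: ideal "supported (E (Suc n)) :: 'a fps set" "A :: 'a fps ring" by (rule ideal_supported_E)
  assume "P \<in> rees" "Q \<in> rees"
  then have "row P n \<in> carrier A" "row Q n \<in> carrier A"
    unfolding A_def ring_on_simps
    by (auto intro!: subsetD[OF supported_mono[OF E_subset_H[of n]]] row_supported)
  from J.a_rcos_sum[OF this] show "proj (P + Q) n = (proj P \<oplus>\<^bsub>G\<^esub> proj Q) n"
    unfolding G_simps proj_def row_add a_r_coset_eq by (simp add: A_def)
qed

lemma proj_one: "proj 1 = \<one>\<^bsub>G\<^esub>"
  by (rule ext) (simp add: G_simps proj_def row_one A_def)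

lemma proj_eq_iff: "proj P = proj Q \<longleftrightarrow> (\<forall>n d. coeff ((P - Q) $ d) n \<noteq> 0 \<longrightarrow> n * s + d \<in> E (Suc n))"
  unfolding fun_eq_iff proj_def coset_eq_iff row_diff[symmetric] row_supported_iff by blast

lemma proj_zero: "proj 0 = \<zero>\<^bsub>G\<^esub>"
  by (rule ext) (simp add: G_simps proj_def row_zero)

lemma proj_closed: "P \<in> rees \<Longrightarrow> proj P \<in> carrier G"
proof -
  assume P: "P \<in> rees"
  obtain D where D: "\<And>d. degree (P $ d) \<le> D" using rees_degree_bound[OF P] by blast
  have "proj P n = coset n 0" if "n > D" for n
  proof -
    have "coeff (P $ d) n = 0" for d using D[of d] that by (intro coeff_eq_0) simp
    then have "row P n = 0" by (intro fps_ext) (simp add: row_nth)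
    then show ?thesis unfolding proj_def by simp
  qed
  then have "{n. proj P n \<noteq> coset n 0} \<subseteq> {..D}" by (auto simp: not_less[symmetric])
  then show "proj P \<in> carrier G"
    unfolding G_carrier using row_supported[OF P] finite_subset[OF _ finite_atMost] by (auto simp: proj_def)
qed

lemma proj_surj:
  assumes "g \<in> carrier G" shows "\<exists>P\<in>rees. g = proj P"
proof -
  have g: "\<forall>n. g n \<in> coset n ` supported (E n)" and fin: "finite {n. g n \<noteq> coset n 0}"
    using assms unfolding G_carrier by auto
  \<comment> \<open>Representing the zero coset by 0 makes \<open>f\<close> vanish in high degrees,
    so that the uniform degree bound of \<open>rees\<close> can be met.\<close>
  have "\<forall>n. \<exists>f. f \<in> supported (E n) \<and> g n = coset n f \<and> (g n = coset n 0 \<longrightarrow> f = 0)"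
    using g by (metis (no_types, lifting) imageE supported_zero)
  then obtain f where f: "\<And>n. f n \<in> supported (E n)" "\<And>n. g n = coset n (f n)"
    "\<And>n. g n = coset n 0 \<Longrightarrow> f n = 0" by metis
  obtain D where "\<forall>n\<in>{n. g n \<noteq> coset n 0}. n \<le> D"
    using fin unfolding finite_nat_set_iff_bounded_le by (rule exE)
  then have D: "f n = 0" if "n > D" for n using f(3)[of n] that by force
  define P where "P = Abs_fps (\<lambda>d. \<Sum>n\<le>D. monom (f n $ (n * s + d)) n)"
  have coeff_P: "coeff (P $ d) n = f n $ (n * s + d)" for d n
    unfolding P_def using D[of n] by (simp add: coeff_sum) 
  have "P \<in> rees"
  proof (rule reesI[of _ D])
    show "n * s + d \<in> E n" if "coeff (P $ d) n \<noteq> 0" for d n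
      using that supportedD[OF f(1)] unfolding coeff_P by blast
    show "degree (P $ d) \<le> D" for d
      using D by (intro degree_le) (simp add: coeff_P)
  qed
  moreover have "row P n = f n" for n
  proof (rule fps_ext)
    fix e
    \<comment> \<open>Nothing is lost by reading off coefficients from n*s on, since every element
      of \<open>E n\<close> is at least n*s.\<close>
    have "f n $ e = 0" if "e < n * s"
      using E_lower[of e n] supportedD[OF f(1)[of n], of e] that by (metis not_le)
    then show "row P n $ e = f n $ e" by (simp add: row_nth coeff_P)
  qed
  then have "g = proj P" unfolding proj_def by (intro ext) (simp add: f(2))
  ultimately show ?thesis by blast
qed

lemma proj_image: "proj ` rees = carrier G"
  using proj_closed proj_surj by fast

lemma proj_hom: "proj \<in> ring_hom (ring_on rees) G"
  by (rule ring_hom_memI) (simp_all add: proj_closed proj_mult proj_add proj_one)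

text \<open>The ring axioms are inherited as those of an image of the Rees ring, instead of being
  checked on cosets.\<close>

lemma G_cring: "cring (G :: (nat \<Rightarrow> 'k::field fps set) ring)"
proof -
  interpret R: cring "ring_on (rees :: 'k poly fps set)" by (rule rees.cring)
  have "ring (G \<lparr>carrier := proj ` (rees :: 'k poly fps set), zero := proj 0\<rparr>)"
    using R.ring_hom_imp_img_ring[OF proj_hom] by simp
  then have "ring (G :: (nat \<Rightarrow> 'k fps set) ring)" unfolding proj_zero proj_image by simp
  then interpret ring "G :: (nat \<Rightarrow> 'k fps set) ring" .
  show ?thesis
  proof (unfold_locales)
    fix g h :: "nat \<Rightarrow> 'k fps set" assume "g \<in> carrier G" "h \<in> carrier G"
    then obtain P Q where "P \<in> rees" "g = proj P" "Q \<in> rees" "h = proj Q" using proj_surj by metis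
    then show "g \<otimes>\<^bsub>G\<^esub> h = h \<otimes>\<^bsub>G\<^esub> g" by (simp flip: proj_mult add: mult.commute)
  qed
qed

end

section \<open>Ideals of the associated graded ring\<close>

lemma poly_ideal_principal:
  fixes L :: "'k::field poly set"
  assumes "0 \<in> L" and add: "\<And>p q. p \<in> L \<Longrightarrow> q \<in> L \<Longrightarrow> p + q \<in> L"
    and mult: "\<And>p q. p \<in> L \<Longrightarrow> q * p \<in> L"
  shows "\<exists>g\<in>L. \<forall>p\<in>L. g dvd p"
proof (cases "L = {0}")
  case False
  then obtain p0 where "p0 \<in> L" "p0 \<noteq> 0" using assms(1) by blast
  then obtain g where g: "g \<in> L" "g \<noteq> 0"
    and least: "\<And>p. p \<in> L \<Longrightarrow> p \<noteq> 0 \<Longrightarrow> degree g \<le> degree p"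
    using exists_least_lemma[of "\<lambda>n. \<exists>p\<in>L. p \<noteq> 0 \<and> degree p = n"]
      ex_has_least_nat[of "\<lambda>p. p \<in> L \<and> p \<noteq> 0" p0 degree] by blast
  have "g dvd p" if "p \<in> L" for p
  proof (rule ccontr)
    assume "\<not> g dvd p"
    then have nz: "p mod g \<noteq> 0" by (simp add: dvd_eq_mod_eq_0)
    have "p mod g = p + (- (p div g)) * g" by (simp add: minus_div_mult_eq_mod)
    also have "\<dots> \<in> L" by (rule add[OF that mult[OF g(1)]])
    finally have "p mod g \<in> L" .
    then show False using least[OF _ nz] degree_mod_less'[OF g(2) nz] by simp
  qed
  then show ?thesis using g by blast
qed simp

text \<open>Induction on the degree of \<open>f\<close> with g = gcd(f, y). If g is constant, y is
  invertible modulo f and n = 0 works. Otherwise f = g*f' with f' of smaller degree, and one further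
  factor y restores the missing g.\<close>

lemma poly_quotient_zero_dimensional:
  fixes f y :: "'k::field poly"
  assumes "f \<noteq> 0"
  shows "\<exists>n b c. (1 - b * y) * y ^ n = f * c"
  using assms
proof (induction "degree f" arbitrary: f rule: less_induct)
  case less
  \<comment> \<open>A generator of the ideal (f, y) is the gcd together with its Bezout
    representation.\<close>
  let ?L = "{u * f + v * y | u v. True}"
  have "\<exists>g\<in>?L. \<forall>p\<in>?L. g dvd p"
  proof (rule poly_ideal_principal)
    show "0 \<in> ?L" by (auto intro!: exI[of _ 0])
    fix p q assume "p \<in> ?L"
    then obtain u v where p: "p = u * f + v * y" by blast
    have "q * p = (q * u) * f + (q * v) * y" unfolding p by (simp add: algebra_simps)
    then show "q * p \<in> ?L" by blast
    assume "q \<in> ?L"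
    then obtain u' v' where q: "q = u' * f + v' * y" by blast
    have "p + q = (u + u') * f + (v + v') * y" unfolding p q by (simp add: algebra_simps)
    then show "p + q \<in> ?L" by blast
  qed
  then obtain g where g: "g \<in> ?L" "\<forall>p\<in>?L. g dvd p" by blast
  obtain u v where uv: "g = u * f + v * y" using g(1) by blast
  have "f = 1 * f + 0 * y" "y = 0 * f + 1 * y" by simp_all
  then have "g dvd f" "g dvd y" using g(2) by blast+
  then obtain f' y' where f': "f = g * f'" and y': "y = g * y'" by (auto elim!: dvdE)
  have nz: "g \<noteq> 0" "f' \<noteq> 0" using less.prems f' by auto
  show ?case
  proof (cases "degree g = 0")
    case True
    then obtain k where k: "g = [:k:]" by (rule degree_eq_zeroE)
    then have "[:inverse k:] * g = 1" using nz by (simp add: one_pCons)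
    then have "1 - [:inverse k:] * v * y = f * ([:inverse k:] * u)"
      unfolding uv by (simp add: algebra_simps)
    then have "(1 - [:inverse k:] * v * y) * y ^ 0 = f * ([:inverse k:] * u)" by simp
    then show ?thesis by blast
  next
    case False
    then have "degree f' < degree f" unfolding f' using nz by (simp add: degree_mult_eq)
    then obtain n b c where IH: "(1 - b * y) * y ^ n = f' * c" using less.hyps nz by blast
    have "(1 - b * y) * y ^ Suc n = f * (c * y')"
      using arg_cong[OF IH, of "\<lambda>p. p * y"] by (subst f', subst (asm) (4) y') (simp add: algebra_simps)
    then show ?thesis by blast
  qed
qed

text \<open>Lowest terms multiply. It is applied first to the powers of X and then to the powers of
  T.\<close>

lemma sum_mult_lowest:
  fixes f g :: "nat \<Rightarrow> 'a::comm_semiring_0"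
  assumes "\<And>k. k < i \<Longrightarrow> f k = 0" "\<And>k. k < n \<Longrightarrow> g k = 0"
  shows "(\<Sum>k\<le>i + n. f k * g (i + n - k)) = f i * g n"
proof -
  have "(\<Sum>k\<le>i + n. f k * g (i + n - k)) = (\<Sum>k\<in>{i}. f k * g (i + n - k))"
  proof (rule sum.mono_neutral_right)
    show "\<forall>k\<in>{..i + n} - {i}. f k * g (i + n - k) = 0"
    proof
      fix k assume k: "k \<in> {..i + n} - {i}"
      then have "k < i \<or> i + n - k < n" by auto
      then show "f k * g (i + n - k) = 0" using assms by auto
    qed
  qed auto
  then show ?thesis by simp
qed

context numerical_semigroup_ideal
begin

text \<open>Here T stands for t^s in degree one, and n*s lies in \<open>E n\<close>. So k[T] is a
  subring of the Rees ring and acts on \<open>G\<close>.\<close>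

lemma const_mem_rees: "fps_const q \<in> rees"
  by (rule reesI[of _ "degree q"]) (auto split: if_splits simp: mult_s_mem_E)

lemma proj_eq_zero_iff:
  "proj P = \<zero>\<^bsub>G\<^esub> \<longleftrightarrow> (\<forall>n d. coeff (P $ d) n \<noteq> 0 \<longrightarrow> n * s + d \<in> E (Suc n))"
  unfolding proj_zero[symmetric] proj_eq_iff by simp

text \<open>From n*s + s + c on, \<open>E (Suc n)\<close> has no gaps. The bound s + c on the power
  of X does not depend on n, so \<open>G\<close> is carried by finitely many powers of X over k[T];
  finite generation and nilpotency both come from this.\<close>

lemma proj_eq_zero_if_deep:
  assumes "\<And>d. d < s + c \<Longrightarrow> P $ d = 0" shows "proj P = \<zero>\<^bsub>G\<^esub>"
  unfolding proj_eq_zero_iff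
proof (intro allI impI)
  fix n d assume "coeff (P $ d) n \<noteq> 0"
  then have "s + c \<le> d" using assms[of d] by (metis coeff_0 not_less)
  then show "n * s + d \<in> E (Suc n)" by (intro E_upper) simp
qed

text \<open>As s > 0, the exponent n*s is too small for \<open>E (Suc n)\<close>. Hence the constant
  term in X is well defined on \<open>G\<close>, which gives the surjection onto k[T].\<close>

lemma constant_term_proj_cong:
  assumes "proj P = proj Q" shows "P $ 0 = Q $ 0"
proof (rule poly_eqI, rule ccontr)
  fix n assume "coeff (P $ 0) n \<noteq> coeff (Q $ 0) n"
  moreover have "coeff ((P - Q) $ 0) n \<noteq> 0 \<longrightarrow> n * s + 0 \<in> E (Suc n)"
    using assms unfolding proj_eq_iff by blast
  ultimately have "n * s \<in> E (Suc n)" by simp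
  then show False using E_lower[of "n * s" "Suc n"] s_pos by simp
qed

lemma G_ideal_proj:
  fixes J :: "'k::field poly fps set"
  assumes "J \<subseteq> rees" "0 \<in> J" "\<And>P Q. P \<in> J \<Longrightarrow> Q \<in> J \<Longrightarrow> P + Q \<in> J"
    and mult: "\<And>P Q. P \<in> J \<Longrightarrow> Q \<in> rees \<Longrightarrow> Q * P \<in> J"
  shows "ideal (proj ` J) G"
proof -
  interpret G: cring "G :: (nat \<Rightarrow> 'k fps set) ring" by (rule G_cring)
  show ?thesis
  proof (rule idealI[OF G.ring_axioms])
    show "subgroup (proj ` J) (add_monoid (G :: (nat \<Rightarrow> 'k fps set) ring))"
    proof (rule G.add.subgroupI)
      show "proj ` J \<subseteq> carrier (G :: (nat \<Rightarrow> 'k fps set) ring)" using assms(1) proj_closed by blast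
      show "proj ` J \<noteq> {}" using assms(2) by blast
    next
      fix g :: "nat \<Rightarrow> 'k fps set" assume "g \<in> proj ` J"
      then obtain P where P: "P \<in> J" "g = proj P" by blast
      have m: "- P \<in> J" using mult[OF P(1) rees.uminus_mem[OF rees.one_mem]] by simp
      have "proj (- P) \<oplus>\<^bsub>G\<^esub> g = \<zero>\<^bsub>G\<^esub>"
        unfolding P(2) using assms(1) P m by (subst proj_add[symmetric]) (auto simp: proj_zero)
      then have "\<ominus>\<^bsub>G\<^esub> g = proj (- P)"
        using assms(1) P m proj_closed by (intro G.minus_equality) auto
      then show "\<ominus>\<^bsub>G\<^esub> g \<in> proj ` J" using m by simp
    next
      fix g h :: "nat \<Rightarrow> 'k fps set" assume "g \<in> proj ` J" "h \<in> proj ` J"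
      then obtain P Q where "P \<in> J" "g = proj P" "Q \<in> J" "h = proj Q" by blast
      moreover from this have "P \<in> rees" "Q \<in> rees" using assms(1) by blast+
      ultimately have "g \<oplus>\<^bsub>G\<^esub> h = proj (P + Q)" "P + Q \<in> J" 
        using proj_add[of P Q] assms(3)[of P Q] by simp_all
      then show "g \<oplus>\<^bsub>G\<^esub> h \<in> proj ` J" by simp
    qed
  next
    fix g h :: "nat \<Rightarrow> 'k fps set" assume "g \<in> proj ` J" "h \<in> carrier G"
    then obtain P Q where PQ: "P \<in> J" "g = proj P" "Q \<in> rees" "h = proj Q" using proj_surj by blast
    have P: "P \<in> rees" using PQ(1) assms(1) by blast
    have "h \<otimes>\<^bsub>G\<^esub> g = proj (Q * P)" unfolding PQ by (rule proj_mult[OF PQ(3) P, symmetric])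
    then show "h \<otimes>\<^bsub>G\<^esub> g \<in> proj ` J" using mult[OF PQ(1,3)] by simp
    moreover have "g \<otimes>\<^bsub>G\<^esub> h = h \<otimes>\<^bsub>G\<^esub> g"
      unfolding PQ by (rule G.m_comm[OF proj_closed[OF P] proj_closed[OF PQ(3)]])
    ultimately show "g \<otimes>\<^bsub>G\<^esub> h \<in> proj ` J" by simp
  qed
qed

definition nil :: "(nat \<Rightarrow> 'k::field fps set) set" where
  "nil = proj ` {P \<in> rees. P $ 0 = 0}"

text \<open>The kernel of \<open>G\<close> -> k[T] -> k with T sent to 0. Besides everything of
  positive degree it contains the classes of degree 0 with zero constant term.\<close>

definition irrelevant :: "(nat \<Rightarrow> 'k::field fps set) set" where
  "irrelevant = proj ` {P \<in> rees. coeff (P $ 0) 0 = 0}"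

lemma proj_mem_nil_iff: "P \<in> rees \<Longrightarrow> proj P \<in> nil \<longleftrightarrow> P $ 0 = 0"
  unfolding nil_def by (auto dest: constant_term_proj_cong)

lemma proj_mem_irrelevant_iff: "P \<in> rees \<Longrightarrow> proj P \<in> irrelevant \<longleftrightarrow> coeff (P $ 0) 0 = 0"
  unfolding irrelevant_def by (auto dest: constant_term_proj_cong)

lemma nil_prime: "primeideal nil (G :: (nat \<Rightarrow> 'k::field fps set) ring)"
proof (rule primeidealI)
  show "ideal nil (G :: (nat \<Rightarrow> 'k fps set) ring)" unfolding nil_def
    by (rule G_ideal_proj) (auto intro: rees.zero_mem rees.add_mem rees.mult_mem)
  show "cring (G :: (nat \<Rightarrow> 'k fps set) ring)" by (rule G_cring)
  have "proj 1 \<notin> (nil :: (nat \<Rightarrow> 'k fps set) set)" using proj_mem_nil_iff[OF rees.one_mem] by simp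
  then show "carrier G \<noteq> (nil :: (nat \<Rightarrow> 'k fps set) set)" using proj_closed[OF rees.one_mem] by blast
next
  fix g h :: "nat \<Rightarrow> 'k fps set" assume "g \<in> carrier G" "h \<in> carrier G" and m: "g \<otimes>\<^bsub>G\<^esub> h \<in> nil"
  then obtain P Q where PQ: "P \<in> rees" "g = proj P" "Q \<in> rees" "h = proj Q" using proj_surj by metis
  then have "proj (P * Q) \<in> nil" using m by (simp only: proj_mult)
  then have "(P * Q) $ 0 = 0" using PQ proj_mem_nil_iff rees.mult_mem by blast
  then show "g \<in> nil \<or> h \<in> nil" using PQ by (simp add: proj_mem_nil_iff)
qed

lemma irrelevant_maximal: "maximalideal irrelevant (G :: (nat \<Rightarrow> 'k::field fps set) ring)"
proof (rule maximalidealI)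
  show "ideal irrelevant (G :: (nat \<Rightarrow> 'k fps set) ring)" unfolding irrelevant_def
    by (rule G_ideal_proj) (auto intro: rees.zero_mem rees.add_mem rees.mult_mem simp: coeff_mult)
  have "proj 1 \<notin> (irrelevant :: (nat \<Rightarrow> 'k fps set) set)"
    using proj_mem_irrelevant_iff[OF rees.one_mem] by simp
  then show "carrier G \<noteq> (irrelevant :: (nat \<Rightarrow> 'k fps set) set)"
    using proj_closed[OF rees.one_mem] by blast
next
  fix J :: "(nat \<Rightarrow> 'k fps set) set"
  assume J: "ideal J G" "irrelevant \<subseteq> J" "J \<subseteq> carrier G"
  interpret J: ideal J G by fact
  show "J = irrelevant \<or> J = carrier G"
  proof (rule disjCI)
    assume "J \<noteq> carrier G"
    then have one: "\<one>\<^bsub>G\<^esub> \<notin> J" using J.one_imp_carrier by blast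
    have "g \<in> irrelevant" if g: "g \<in> J" for g
    proof -
      obtain P where P: "P \<in> rees" "g = proj P" using g J(3) proj_surj by blast
      define a where "a = coeff (P $ 0) 0"
      have "a = 0"
      proof (rule ccontr)
        assume a: "a \<noteq> 0"
        \<comment> \<open>Scaling by 1/a makes the constant term 1, so 1 - u*P is irrelevant and
          lies in \<open>J\<close>.\<close>
        define u where "u = (fps_const [:1 / a:] :: 'k poly fps)"
        have u: "u \<in> rees" unfolding u_def by (rule const_mem_rees)
        have "proj (u * P) \<in> J" using J.I_l_closed[OF g proj_closed[OF u]] P u by (simp add: proj_mult)
        moreover have Q: "1 - u * P \<in> rees" by (intro rees.diff_mem rees.one_mem rees.mult_mem u P)
        then have "proj (1 - u * P) \<in> J"
          using proj_mem_irrelevant_iff[OF Q] J(2) a by (auto simp: u_def a_def)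
        ultimately have "proj (1 - u * P) \<oplus>\<^bsub>G\<^esub> proj (u * P) \<in> J" by (simp add: J.a_closed)
        moreover have "proj (1 - u * P) \<oplus>\<^bsub>G\<^esub> proj (u * P) = \<one>\<^bsub>G\<^esub>"
          using proj_add[OF Q rees.mult_mem[OF u P(1)]] by (simp add: proj_one)
        ultimately show False using one by simp
      qed
      then show ?thesis using P a_def by (simp add: proj_mem_irrelevant_iff)
    qed
    then show "J = irrelevant" using J(2) by blast
  qed
qed

lemma nil_less_irrelevant: "nil \<subset> (irrelevant :: (nat \<Rightarrow> 'k::field fps set) set)"
proof -
  have T: "fps_const (monom 1 1) \<in> (rees :: 'k poly fps set)" by (rule const_mem_rees)
  have "proj (fps_const (monom 1 1)) \<in> (irrelevant :: (nat \<Rightarrow> 'k fps set) set)"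
    "proj (fps_const (monom 1 1)) \<notin> (nil :: (nat \<Rightarrow> 'k fps set) set)"
    unfolding proj_mem_nil_iff[OF T] proj_mem_irrelevant_iff[OF T] by (simp_all add: monom_eq_0_iff)
  moreover have "nil \<subseteq> (irrelevant :: (nat \<Rightarrow> 'k fps set) set)" unfolding nil_def irrelevant_def by force
  ultimately show ?thesis by blast
qed

text \<open>The monomial t^e in degree m lies in the socle. A factor of degree 0 without constant
  term raises the exponent beyond e, where \<open>above\<close> applies; a factor of degree k > 0
  adds at least k*s, where \<open>shift\<close> applies.\<close>

lemma not_Cohen_Macaulay_G:
  assumes e: "e \<in> E m" "e \<notin> E (Suc m)"
    and above: "\<And>x. e < x \<Longrightarrow> x \<in> E (Suc m)"
    and shift: "\<And>k x. 0 < k \<Longrightarrow> e + k * s \<le> x \<Longrightarrow> x \<in> E (Suc (m + k))"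
  shows "\<not> Cohen_Macaulay (G :: (nat \<Rightarrow> 'k::field fps set) ring)"
proof -
  interpret G: cring "G :: (nat \<Rightarrow> 'k fps set) ring" by (rule G_cring)
  define t where "t = e - m * s"
  have et: "m * s + t = e" unfolding t_def using E_lower[OF e(1)] by simp
  define W where "W = fps_X ^ t * fps_const (monom (1::'k) m)"
  have W_coeff: "coeff (W $ d) n = (if d = t \<and> n = m then 1 else 0)" for d n
    unfolding W_def by (auto simp: fps_X_power_mult_nth)
  have W: "W \<in> rees"
  proof (rule reesI[of _ m])
    show "n * s + d \<in> E n" if "coeff (W $ d) n \<noteq> 0" for d n
      using that e(1) et by (auto simp: W_coeff split: if_splits)
    show "degree (W $ d) \<le> m" for d by (rule degree_le) (simp add: W_coeff)
  qed
  show ?thesis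
  proof (rule G.not_Cohen_Macaulay_if_socle)
    show "primeideal nil (G :: (nat \<Rightarrow> 'k fps set) ring)" by (rule nil_prime)
    show "maximalideal irrelevant (G :: (nat \<Rightarrow> 'k fps set) ring)" by (rule irrelevant_maximal)
    show "nil \<subset> (irrelevant :: (nat \<Rightarrow> 'k fps set) set)" by (rule nil_less_irrelevant)
    show "proj W \<in> carrier G" by (rule proj_closed[OF W])
    show "proj W \<noteq> \<zero>\<^bsub>G\<^esub>"
      unfolding proj_eq_zero_iff using e(2) et W_coeff by (metis one_neq_zero)
  next
    fix g :: "nat \<Rightarrow> 'k fps set" assume "g \<in> irrelevant"
    then obtain P where P: "P \<in> rees" "g = proj P" "coeff (P $ 0) 0 = 0" unfolding irrelevant_def by auto
    have "proj (P * W) = \<zero>\<^bsub>G\<^esub>" unfolding proj_eq_zero_iff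
    proof (intro allI impI)
      fix n d assume *: "coeff ((P * W) $ d) n \<noteq> 0"
      have "P * W = fps_X ^ t * (fps_const (monom 1 m) * P)" unfolding W_def by (simp add: ac_simps)
      then have **: "(P * W) $ d = (if d < t then 0 else monom 1 m * P $ (d - t))"
        by (simp only: fps_X_power_mult_nth fps_mult_left_const_nth)
      from * have d: "t \<le> d" "m \<le> n" and nz: "coeff (P $ (d - t)) (n - m) \<noteq> 0"
        unfolding ** by (auto simp: coeff_monom_mult not_less split: if_splits)
      have eq: "n * s + d = e + (n - m) * s + (d - t)"
      proof -
        have "n * s = m * s + (n - m) * s" using d(2) by (simp flip: distrib_right)
        then show ?thesis using d(1) et by simp
      qed
      show "n * s + d \<in> E (Suc n)"
      proof (cases "n = m")
        case True
        then have "d - t \<noteq> 0" using nz P(3) by (metis diff_self_eq_0)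
        then show ?thesis unfolding eq using True above[of "e + (d - t)"] by simp
      next
        case False
        then have "m + (n - m) = n" "0 < n - m" using d(2) by auto
        then show ?thesis unfolding eq using shift[of "n - m" "e + (n - m) * s + (d - t)"] by simp
      qed
    qed
    then show "g \<otimes>\<^bsub>G\<^esub> proj W = \<zero>\<^bsub>G\<^esub>" using P W by (simp only: proj_mult)
  qed
qed

text \<open>A variant of the Hilbert basis argument: the coefficients of X^m in the elements of
  \<open>J\<close> of order at least m form an ideal of k[T], which is principal. Lifts of the
  generators for m < s + c generate \<open>J\<close>, because elements of higher order vanish in
  \<open>G\<close>.\<close>

lemma G_noetherian: "noetherian_ring (G :: (nat \<Rightarrow> 'k::field fps set) ring)"
proof -
  interpret G: cring "G :: (nat \<Rightarrow> 'k fps set) ring" by (rule G_cring)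
  show ?thesis
  proof (rule G.noetherian_ringI)
    fix J :: "(nat \<Rightarrow> 'k fps set) set" assume "ideal J G"
    then interpret J: ideal J G .
    define L where "L m = {P \<in> rees. proj P \<in> J \<and> (\<forall>d<m. P $ d = 0)}" for m
    have L_zero: "0 \<in> L m" for m
      unfolding L_def using rees.zero_mem J.zero_closed by (simp add: proj_zero)
    have L_add: "P + Q \<in> L m" if "P \<in> L m" "Q \<in> L m" for P Q m
      using that rees.add_mem[of P Q] proj_add[of P Q] J.a_closed[of "proj P" "proj Q"] unfolding L_def by simp
    have L_mult: "Q * P \<in> L m" if "Q \<in> rees" "P \<in> L m" for P Q m
    proof -
      have "(Q * P) $ d = 0" if "d < m" for d
        using \<open>P \<in> L m\<close> that unfolding L_def fps_mult_nth by (intro sum.neutral) auto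
      then show ?thesis
        using that rees.mult_mem[of Q P] proj_mult[of Q P] J.I_l_closed[of "proj P" "proj Q"] proj_closed[of Q]
        unfolding L_def by simp
    qed
    have "\<exists>P\<in>L m. \<forall>Q\<in>L m. P $ m dvd Q $ m" for m
    proof -
      have "\<exists>p\<in>(\<lambda>P. P $ m) ` L m. \<forall>q\<in>(\<lambda>P. P $ m) ` L m. p dvd q"
      proof (rule poly_ideal_principal)
        show "0 \<in> (\<lambda>P. P $ m) ` L m" using L_zero[of m] by (auto intro!: image_eqI[of _ _ 0])
      next
        fix p q assume "p \<in> (\<lambda>P. P $ m) ` L m" "q \<in> (\<lambda>P. P $ m) ` L m"
        then obtain P Q where "P \<in> L m" "p = P $ m" "Q \<in> L m" "q = Q $ m" by blast
        then show "p + q \<in> (\<lambda>P. P $ m) ` L m" using L_add by (intro image_eqI[of _ _ "P + Q"]) simp_all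
      next
        fix p q assume "p \<in> (\<lambda>P. P $ m) ` L m"
        then obtain P where "P \<in> L m" "p = P $ m" by blast
        then show "q * p \<in> (\<lambda>P. P $ m) ` L m"
          using L_mult[OF const_mem_rees[of q]] by (intro image_eqI[of _ _ "fps_const q * P"]) simp_all
      qed
      then show ?thesis by blast
    qed
    then obtain g where g: "\<And>m. g m \<in> L m" "\<And>m Q. Q \<in> L m \<Longrightarrow> g m $ m dvd Q $ m" by metis
    let ?A = "(\<lambda>m. proj (g m)) ` {..<s + c}"
    have A: "?A \<subseteq> J" "?A \<subseteq> carrier G" using g(1) J.Icarr unfolding L_def by auto
    interpret I: ideal "Idl\<^bsub>G\<^esub> ?A" G by (rule G.genideal_ideal[OF A(2)])
    \<comment> \<open>Induction towards lower order: \<open>k\<close> is the number of orders still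
      below s + c, and one step clears the coefficient of X^m by a k[T]-multiple of
      \<open>g m\<close>.\<close>
    have reduce: "proj P \<in> Idl\<^bsub>G\<^esub> ?A" if "P \<in> L (s + c - k)" "k \<le> s + c" for P k
      using that
    proof (induction k arbitrary: P)
      case 0
      then have "proj P = \<zero>\<^bsub>G\<^esub>" unfolding L_def by (intro proj_eq_zero_if_deep) simp
      then show ?case using I.zero_closed by simp
    next
      case (Suc k)
      define m where "m = s + c - Suc k"
      have m: "s + c - k = Suc m" "m < s + c" using Suc.prems unfolding m_def by auto
      have P: "P \<in> L m" using Suc.prems m_def by simp
      obtain q where q: "P $ m = g m $ m * q" using g(2)[OF P] by (elim dvdE)
      define Q where "Q = fps_const q * g m"
      have Q: "Q \<in> L m" unfolding Q_def by (rule L_mult[OF const_mem_rees g(1)])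
      have "P + fps_const (- 1) * Q \<in> L m" by (intro L_add P L_mult Q const_mem_rees)
      moreover have "(P + fps_const (- 1) * Q) $ m = 0" unfolding Q_def by (simp add: q mult.commute)
      ultimately have "P + fps_const (- 1) * Q \<in> L (Suc m)" unfolding L_def by (auto simp: less_Suc_eq)
      then have "proj (P + fps_const (- 1) * Q) \<in> Idl\<^bsub>G\<^esub> ?A" using Suc.IH Suc.prems(2) m(1) by simp
      moreover have "proj Q \<in> Idl\<^bsub>G\<^esub> ?A"
      proof -
        have "proj (g m) \<in> Idl\<^bsub>G\<^esub> ?A" using G.genideal_self[OF A(2)] m(2) by blast
        then have "proj (fps_const q) \<otimes>\<^bsub>G\<^esub> proj (g m) \<in> Idl\<^bsub>G\<^esub> ?A"
          by (rule I.I_l_closed[OF _ proj_closed[OF const_mem_rees]])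
        moreover have "g m \<in> rees" using g(1) unfolding L_def by blast
        ultimately show ?thesis unfolding Q_def by (simp add: proj_mult const_mem_rees)
      qed
      ultimately have "proj (P + fps_const (- 1) * Q) \<oplus>\<^bsub>G\<^esub> proj Q \<in> Idl\<^bsub>G\<^esub> ?A" by (rule I.a_closed)
      moreover have "P + fps_const (- 1) * Q \<in> rees" "Q \<in> rees"
        using \<open>P + fps_const (- 1) * Q \<in> L m\<close> Q unfolding L_def by blast+
      then have "proj (P + fps_const (- 1) * Q) \<oplus>\<^bsub>G\<^esub> proj Q = proj (P + fps_const (- 1) * Q + Q)"
        by (rule proj_add[symmetric])
      moreover have "P + fps_const (- 1) * Q + Q = P"
        by (rule fps_ext) (simp add: algebra_simps)
      ultimately show ?case by simp
    qed
    have "J = Idl\<^bsub>G\<^esub> ?A"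
    proof
      show "J \<subseteq> Idl\<^bsub>G\<^esub> ?A"
      proof
        fix h assume h: "h \<in> J"
        then obtain P where P: "P \<in> rees" "h = proj P" using J.Icarr proj_surj by blast
        then show "h \<in> Idl\<^bsub>G\<^esub> ?A" using reduce[of P "s + c"] h unfolding L_def by simp
      qed
      show "Idl\<^bsub>G\<^esub> ?A \<subseteq> J" by (rule G.genideal_minimal[OF J.ideal_axioms A(1)])
    qed
    then show "\<exists>A\<subseteq>carrier G. finite A \<and> J = Idl\<^bsub>G\<^esub> A" using A(2) by blast
  qed
qed

text \<open>The power s + c of a series without constant term has order at least s + c.\<close>

lemma nil_nilpotent:
  assumes "P \<in> rees" "P $ 0 = 0" shows "proj (P ^ (s + c)) = \<zero>\<^bsub>G\<^esub>"
  by (rule proj_eq_zero_if_deep) (use startsby_zero_power_prefix[OF assms(2)] in blast)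

lemma proj_power: "P \<in> rees \<Longrightarrow> proj (P ^ n) = proj P [^]\<^bsub>G\<^esub> n"
proof (induction n)
  case (Suc n)
  then have "proj (P ^ n * P) = proj P [^]\<^bsub>G\<^esub> n \<otimes>\<^bsub>G\<^esub> proj P"
    by (simp add: proj_mult rees.power_mem)
  then show ?case by (simp add: mult.commute)
qed (simp add: proj_one)

text \<open>The hypothesis says that the initial form of \<open>t^s\<close> is a nonzerodivisor.\<close>

lemma E_cancel:
  assumes "\<And>n e. e \<in> E n \<Longrightarrow> e + s \<in> E (Suc (Suc n)) \<Longrightarrow> e \<in> E (Suc n)"
  shows "e \<in> E n \<Longrightarrow> e + i * s \<in> E (Suc (n + i)) \<Longrightarrow> e \<in> E (Suc n)"
proof (induction i)
  case (Suc i)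
  have "e + i * s \<in> E (n + i)" by (rule E_add[OF Suc.prems(1) mult_s_mem_E])
  moreover have "e + i * s + s \<in> E (Suc (Suc (n + i)))"
    using Suc.prems(2) by (simp add: algebra_simps del: E.simps)
  ultimately show ?case using assms Suc by blast
qed simp

text \<open>Lowest terms are compared, first in X and then in T. The lowest term of
  \<open>P $ 0\<close> in T is a multiple of T^i, the i-th power of the initial form of t^s, so
  \<open>E_cancel\<close> removes it and leaves a monomial of the reduced representative of
  \<open>Q\<close> that ought to have been discarded.\<close>

lemma nonzerodivisor_outside_nil:
  assumes cancel: "\<And>n e. e \<in> E n \<Longrightarrow> e + s \<in> E (Suc (Suc n)) \<Longrightarrow> e \<in> E (Suc n)"
    and P: "P \<in> rees" "P $ 0 \<noteq> 0" and Q: "Q \<in> rees" and PQ: "proj (P * Q) = \<zero>\<^bsub>G\<^esub>"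
  shows "proj Q = \<zero>\<^bsub>G\<^esub>"
proof -
  obtain D where D: "\<And>d. degree (Q $ d) \<le> D" using rees_degree_bound[OF Q] by (auto elim: exE)
  text \<open>The representative of \<^term>\<open>proj Q\<close> without the monomials that vanish in \<^term>\<open>G\<close>.\<close>
  define R where "R = Abs_fps (\<lambda>d. \<Sum>n\<le>D. if n * s + d \<in> E (Suc n) then 0 else monom (coeff (Q $ d) n) n)"
  have coeff_R: "coeff (R $ d) n = (if n * s + d \<in> E (Suc n) then 0 else coeff (Q $ d) n)" for d n
  proof -
    have "coeff (R $ d) n = (\<Sum>k\<le>D. if k = n then if n * s + d \<in> E (Suc n) then 0 else coeff (Q $ d) n else 0)"
      unfolding R_def fps_nth_Abs_fps coeff_sum by (rule sum.cong) auto
    also have "\<dots> = (if n * s + d \<in> E (Suc n) then 0 else coeff (Q $ d) n)"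
      using D[of d] coeff_eq_0[of "Q $ d" n] by (auto simp: sum.delta)
    finally show ?thesis .
  qed
  have R: "R \<in> rees"
  proof (rule reesI[of _ D])
    show "n * s + d \<in> E n" if "coeff (R $ d) n \<noteq> 0" for d n
      using that reesD[OF Q, of d n] by (auto simp: coeff_R split: if_splits)
    show "degree (R $ d) \<le> D" for d
      using D[of d] by (intro degree_le) (auto simp: coeff_R coeff_eq_0)
  qed
  have "proj Q = proj R" unfolding proj_eq_iff by (auto simp: coeff_R split: if_splits)
  then have "proj (P * R) = \<zero>\<^bsub>G\<^esub>" using PQ P Q R by (simp add: proj_mult)
  then have PR: "n * s + d \<in> E (Suc n)" if "coeff ((P * R) $ d) n \<noteq> 0" for n d
    using that unfolding proj_eq_zero_iff by blast
  have "R = 0"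
  proof (rule ccontr)
    assume "R \<noteq> 0"
    define d where "d = subdegree R"
    have "(P * R) $ d = (\<Sum>k\<le>0 + d. P $ k * R $ (0 + d - k))"
      by (simp add: fps_mult_nth atLeast0AtMost)
    also have "\<dots> = P $ 0 * R $ d" by (rule sum_mult_lowest) (simp_all add: d_def nth_less_subdegree_zero)
    finally have PR_d: "(P * R) $ d = P $ 0 * R $ d" .
    have "R $ d \<noteq> 0" unfolding d_def using \<open>R \<noteq> 0\<close> by simp
    define i where "i = (LEAST i. coeff (P $ 0) i \<noteq> 0)"
    define n where "n = (LEAST n. coeff (R $ d) n \<noteq> 0)"
    have ex: "\<exists>i. coeff p i \<noteq> 0" if "p \<noteq> 0" for p :: "'a poly" using that by (simp add: poly_eq_iff)
    have i: "coeff (P $ 0) i \<noteq> 0" "\<And>k. k < i \<Longrightarrow> coeff (P $ 0) k = 0"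
      unfolding i_def using LeastI_ex[OF ex[OF P(2)]] not_less_Least by blast+
    have n: "coeff (R $ d) n \<noteq> 0" "\<And>k. k < n \<Longrightarrow> coeff (R $ d) k = 0"
      unfolding n_def using LeastI_ex[OF ex[OF \<open>R $ d \<noteq> 0\<close>]] not_less_Least by blast+
    have "coeff ((P * R) $ d) (i + n) = coeff (P $ 0) i * coeff (R $ d) n"
      unfolding PR_d coeff_mult by (rule sum_mult_lowest) (use i n in auto)
    then have "(i + n) * s + d \<in> E (Suc (i + n))" using PR i n by simp
    moreover have "n * s + d + i * s = (i + n) * s + d" "n + i = i + n" by (simp_all add: algebra_simps)
    ultimately have "n * s + d + i * s \<in> E (Suc (n + i))" by (simp only:)
    moreover have "n * s + d \<in> E n" using reesD[OF R n(1)] .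
    ultimately have "n * s + d \<in> E (Suc n)" using E_cancel[OF cancel] by blast
    then show False using n(1) unfolding coeff_R by simp
  qed
  then show ?thesis using \<open>proj Q = proj R\<close> proj_zero by simp
qed

lemma power_add_multiple:
  assumes "P \<in> rees" "C \<in> rees" "Z \<in> rees"
  shows "\<exists>C'\<in>rees. (P * C + Z) ^ n = P * C' + Z ^ n"
proof (induction n)
  case 0
  show ?case by (rule bexI[OF _ rees.zero_mem]) simp
next
  case (Suc n)
  then obtain C' where C': "C' \<in> rees" "(P * C + Z) ^ n = P * C' + Z ^ n" by blast
  have "(P * C + Z) ^ Suc n = P * (C * (P * C' + Z ^ n) + Z * C') + Z ^ Suc n"
    unfolding power_Suc C'(2) by (simp add: algebra_simps)
  moreover have "C * (P * C' + Z ^ n) + Z * C' \<in> rees"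
    by (intro rees.add_mem rees.mult_mem rees.power_mem assms C'(1))
  ultimately show ?case by blast
qed

text \<open>The identity in k[T] lifts to the Rees ring up to an error \<open>Z\<close> without
  constant term. Raising it to the power s + c kills the error modulo \<open>P\<close>.\<close>

lemma G_zero_dimensional_quotient:
  assumes P: "P \<in> rees" "P $ 0 \<noteq> 0" and Y: "Y \<in> rees"
  shows "\<exists>n. \<exists>B\<in>rees. \<exists>C\<in>rees. proj ((1 - B * Y) * Y ^ n) = proj (P * C)"
proof -
  obtain n b c' where bc: "(1 - b * Y $ 0) * (Y $ 0) ^ n = P $ 0 * c'"
    using poly_quotient_zero_dimensional[OF P(2)] by blast
  define Z where "Z = (1 - fps_const b * Y) * Y ^ n - P * fps_const c'"
  have Z: "Z \<in> rees" unfolding Z_def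
    by (intro rees.diff_mem rees.mult_mem rees.one_mem rees.power_mem const_mem_rees P Y)
  have "Z $ 0 = 0" unfolding Z_def using bc by (simp add: fps_nth_power_0)
  then have Zz: "proj (Z ^ (s + c)) = proj 0" by (simp add: nil_nilpotent[OF Z] proj_zero)
  obtain C where C: "C \<in> rees" "(P * fps_const c' + Z) ^ (s + c) = P * C + Z ^ (s + c)"
    using power_add_multiple[OF P(1) const_mem_rees Z] by blast
  \<comment> \<open>The power of 1 - b*Y must again have the form 1 minus a multiple of
    \<open>Y\<close>; expanding around 1 modulo \<open>Y\<close> shows this.\<close>
  obtain B where B: "B \<in> rees" "(Y * - fps_const b + 1) ^ (s + c) = Y * B + 1 ^ (s + c)"
    using power_add_multiple[OF Y rees.uminus_mem[OF const_mem_rees] rees.one_mem] by blast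
  have "(1 - (- B) * Y) * Y ^ (n * (s + c)) = ((1 - fps_const b * Y) * Y ^ n) ^ (s + c)"
  proof -
    have "Y * - fps_const b + 1 = 1 - fps_const b * Y"
      by (simp only: mult_minus_right mult.commute[of Y] uminus_add_conv_diff)
    then have "1 - (- B) * Y = (1 - fps_const b * Y) ^ (s + c)" using B(2) by (simp add: mult.commute[of Y])
    then show ?thesis by (simp only: power_mult_distrib power_mult)
  qed
  also have "(1 - fps_const b * Y) * Y ^ n = P * fps_const c' + Z" unfolding Z_def by simp
  also note C(2)
  finally have "(1 - (- B) * Y) * Y ^ (n * (s + c)) = P * C + Z ^ (s + c)" .
  moreover have "proj (P * C + Z ^ (s + c)) = proj (P * C + 0)"
    using Zz by (simp only: proj_add rees.mult_mem P C rees.power_mem Z rees.zero_mem)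
  ultimately show ?thesis using C(1) rees.uminus_mem[OF B(1)] by (metis add_0_right)
qed

theorem Cohen_Macaulay_G:
  assumes cancel: "\<And>n e. e \<in> E n \<Longrightarrow> e + s \<in> E (Suc (Suc n)) \<Longrightarrow> e \<in> E (Suc n)"
  shows "Cohen_Macaulay (G :: (nat \<Rightarrow> 'k::field fps set) ring)"
proof -
  interpret G: noetherian_ring "G :: (nat \<Rightarrow> 'k fps set) ring" by (rule G_noetherian)
  interpret G: cring "G :: (nat \<Rightarrow> 'k fps set) ring" by (rule G_cring)
  interpret irr: maximalideal irrelevant "G :: (nat \<Rightarrow> 'k fps set) ring" by (rule irrelevant_maximal)
  show ?thesis
  proof (rule G.Cohen_Macaulay_if_one_dimensional)
    show "cring (G :: (nat \<Rightarrow> 'k fps set) ring)" by (rule G_cring)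
    show "primeideal nil (G :: (nat \<Rightarrow> 'k fps set) ring)" by (rule nil_prime)
    show "\<not> maximalideal nil (G :: (nat \<Rightarrow> 'k fps set) ring)"
    proof
      assume "maximalideal nil (G :: (nat \<Rightarrow> 'k fps set) ring)"
      then interpret nil: maximalideal nil "G :: (nat \<Rightarrow> 'k fps set) ring" .
      show False
        using nil.I_maximal[OF irr.ideal_axioms] nil_less_irrelevant irr.I_notcarr irr.Icarr by blast
    qed
  next
    fix g :: "nat \<Rightarrow> 'k fps set" assume "g \<in> nil"
    then obtain P where P: "P \<in> rees" "P $ 0 = 0" "g = proj P" unfolding nil_def by blast
    have "g [^]\<^bsub>G\<^esub> (s + c) = \<zero>\<^bsub>G\<^esub>" unfolding P(3) proj_power[OF P(1), symmetric]
      by (rule nil_nilpotent[OF P(1,2)])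
    then show "\<exists>n::nat. g [^]\<^bsub>G\<^esub> n = \<zero>\<^bsub>G\<^esub>" by blast
  next
    fix g h :: "nat \<Rightarrow> 'k fps set"
    assume "g \<in> carrier G" "g \<notin> nil" "h \<in> carrier G"
    then obtain P Q where PQ: "P \<in> rees" "g = proj P" "Q \<in> rees" "h = proj Q" using proj_surj by metis
    have P0: "P $ 0 \<noteq> 0" using \<open>g \<notin> nil\<close> PQ by (simp add: proj_mem_nil_iff)
    show "h = \<zero>\<^bsub>G\<^esub>" if "g \<otimes>\<^bsub>G\<^esub> h = \<zero>\<^bsub>G\<^esub>"
      unfolding PQ by (rule nonzerodivisor_outside_nil[OF cancel PQ(1) P0 PQ(3)])
        (use that PQ in \<open>simp_all add: proj_mult\<close>)
    obtain n B C where BC: "B \<in> rees" "C \<in> rees" "proj ((1 - B * Q) * Q ^ n) = proj (P * C)"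
      using G_zero_dimensional_quotient[OF PQ(1) P0 PQ(3)] by blast
    have BQ: "1 - B * Q \<in> rees" by (intro rees.diff_mem rees.one_mem rees.mult_mem BC PQ)
    have "proj (1 - B * Q) \<oplus>\<^bsub>G\<^esub> proj B \<otimes>\<^bsub>G\<^esub> h = proj (1 - B * Q + B * Q)"
      using BQ BC PQ by (simp only: proj_add proj_mult rees.mult_mem)
    also have "\<dots> = \<one>\<^bsub>G\<^esub>" by (simp add: proj_one)
    finally have "\<one>\<^bsub>G\<^esub> \<ominus>\<^bsub>G\<^esub> proj B \<otimes>\<^bsub>G\<^esub> h = proj (1 - B * Q)"
      using BQ BC PQ proj_closed
      by (metis G.add.inv_solve_right' G.m_closed G.minus_eq G.one_closed)
    then have "(\<one>\<^bsub>G\<^esub> \<ominus>\<^bsub>G\<^esub> proj B \<otimes>\<^bsub>G\<^esub> h) \<otimes>\<^bsub>G\<^esub> h [^]\<^bsub>G\<^esub> n = g \<otimes>\<^bsub>G\<^esub> proj C"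
      using BC BQ PQ by (simp add: proj_mult proj_power rees.power_mem)
    then show "\<exists>(n::nat). \<exists>b\<in>carrier G. \<exists>c\<in>carrier G.
        (\<one>\<^bsub>G\<^esub> \<ominus>\<^bsub>G\<^esub> b \<otimes>\<^bsub>G\<^esub> h) \<otimes>\<^bsub>G\<^esub> h [^]\<^bsub>G\<^esub> n = g \<otimes>\<^bsub>G\<^esub> c"
      using BC proj_closed by blast
  qed
qed

text \<open>
  Here the filtration misses a monomial in degree 2 but nothing from some degree on; the largest
  monomial missing in the last incomplete degree gives a socle element.
\<close>

lemma not_Cohen_Macaulay_G_if_delayed_filling:
  assumes c: "c \<le> 2 * s" and x2: "2 * s \<le> x2" "x2 \<notin> E 2"
    and fill: "2 \<le> N" "\<And>x. N * s \<le> x \<Longrightarrow> x \<in> E N"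
  shows "\<not> Cohen_Macaulay (G :: (nat \<Rightarrow> 'k::field fps set) ring)"
proof -
  define full where "full k \<longleftrightarrow> (\<forall>x. k * s \<le> x \<longrightarrow> x \<in> E k)" for k
  have full_Suc: "full (Suc k)" if "full k" for k
    unfolding full_def
  proof (intro allI impI)
    fix x assume "Suc k * s \<le> x"
    then have "k * s \<le> x - s" "s \<le> x" by simp_all
    then have "x - s \<in> E k" using that full_def by blast
    then show "x \<in> E (Suc k)" using E_SucI[of "x - s" k s] s_mem \<open>s \<le> x\<close> by simp
  qed
  have "\<not> full 2" using x2 full_def by blast
  have "\<exists>m\<ge>2. \<not> full m \<and> full (Suc m)"
  proof (rule ccontr)
    assume *: "\<not> (\<exists>m\<ge>2. \<not> full m \<and> full (Suc m))"
    have "\<not> full k" if "2 \<le> k" for k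
      using that by (induction k rule: dec_induct) (use * \<open>\<not> full 2\<close> in auto)
    then show False using fill full_def by blast
  qed
  then obtain m where m: "2 \<le> m" "\<not> full m" "full (Suc m)" by blast
  define gaps where "gaps = {x. m * s \<le> x \<and> x \<notin> E m}"
  have gaps: "finite gaps" "gaps \<noteq> {}"
  proof -
    have "x \<le> m * s + c" if "x \<in> gaps" for x
      using E_upper[of m x] that unfolding gaps_def by (cases "x \<le> m * s + c") auto
    then have "gaps \<subseteq> {..m * s + c}" by auto
    then show "finite gaps" by (rule finite_subset) simp
    show "gaps \<noteq> {}" using m(2) unfolding full_def gaps_def by blast
  qed
  define e where "e = Max gaps"
  have e: "m * s \<le> e" "e \<notin> E m" using Max_in[OF gaps] unfolding e_def gaps_def by auto
  have above: "x \<in> E m" if "e < x" for x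
  proof (rule ccontr)
    assume "x \<notin> E m"
    then have "x \<in> gaps" using that e(1) unfolding gaps_def by simp
    then show False using Max_ge[OF gaps(1), of x] that unfolding e_def by simp
  qed
  \<comment> \<open>Once a degree is complete, adding \<open>s\<close> keeps all later ones
    complete; this supplies the hypothesis \<open>shift\<close>.\<close>
  have full_add: "full (Suc m + k)" for k by (induction k) (use m(3) full_Suc in auto)
  obtain m' where m': "m = Suc (Suc m')" using m(1) by (metis add_2_eq_Suc le_Suc_ex)
  \<comment> \<open>Here c <= 2*s enters: e is the sum of m'*s and a number beyond the conductor and
    above s, so it lies one power deeper than m', though not in \<open>E m\<close>.\<close>
  have "2 * s \<le> e - m' * s" "m' * s \<le> e" using e(1) unfolding m' by auto
  then have "m' * s + (e - m' * s) \<in> E (Suc m')"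
    using c by (intro E_SucI mult_s_mem_E H_conductor) auto
  then have "e \<in> E (Suc m')" using \<open>m' * s \<le> e\<close> by simp
  then show ?thesis
  proof (rule not_Cohen_Macaulay_G)
    show "e \<notin> E (Suc (Suc m'))" using e(2) m' by blast
    show "x \<in> E (Suc (Suc m'))" if "e < x" for x using above[OF that] m' by blast
    show "x \<in> E (Suc (Suc m' + k))" if k: "0 < k" "e + k * s \<le> x" for k x
    proof -
      obtain k' where k': "k = Suc k'" using k(1) by (cases k) auto
      have "(Suc m + k') * s \<le> x" using k(2) e(1) unfolding k' by (simp add: algebra_simps)
      then have "x \<in> E (Suc m + k')" using full_add full_def by blast
      then show ?thesis unfolding k' m' by (simp del: E.simps)
    qed
  qed
qed

end

section \<open>Rings generated by two monomials\<close>

definition gen2 :: "nat \<Rightarrow> nat \<Rightarrow> nat set" where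
  "gen2 a b = {a * i + b * j | i j. True}"

lemma gen2_add: "x \<in> gen2 a b \<Longrightarrow> y \<in> gen2 a b \<Longrightarrow> x + y \<in> gen2 a b"
proof -
  assume "x \<in> gen2 a b" "y \<in> gen2 a b"
  then obtain i j i' j' where "x = a * i + b * j" "y = a * i' + b * j'" unfolding gen2_def by blast
  then have "x + y = a * (i + i') + b * (j + j')" by (simp add: algebra_simps)
  then show ?thesis unfolding gen2_def by blast
qed

lemma fps_subring2_eq:
  assumes "0 < a" "0 < b"
  shows "fps_subring2 a b = ring_on (supported (gen2 a b) :: 'k::field fps set)"
proof -
  define S where "S n = {(i, j). a * i + b * j = n}" for n
  have S: "finite (S n)" for n
  proof (rule finite_subset)
    have "i \<le> a * i + b * j \<and> j \<le> a * i + b * j" for i j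
      using assms by (metis One_nat_def Suc_leI le_add1 le_add2 le_trans mult_le_mono1 nat_mult_1)
    then show "S n \<subseteq> {..n} \<times> {..n}" unfolding S_def by auto
  qed simp
  have "{Abs_fps (\<lambda>n. \<Sum>(i, j)\<in>S n. c i j) | c :: nat \<Rightarrow> nat \<Rightarrow> 'k. True} = supported (gen2 a b)"
  proof (intro subset_antisym subsetI)
    fix f :: "'k fps" assume "f \<in> {Abs_fps (\<lambda>n. \<Sum>(i, j)\<in>S n. c i j) | c. True}"
    then obtain c where f: "f = Abs_fps (\<lambda>n. \<Sum>(i, j)\<in>S n. c i j)" by blast
    show "f \<in> supported (gen2 a b)"
    proof (rule supportedI)
      fix n assume "f $ n \<noteq> 0"
      then have "S n \<noteq> {}" unfolding f by auto
      then show "n \<in> gen2 a b" unfolding S_def gen2_def by auto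
    qed
  next
    fix f :: "'k fps" assume f: "f \<in> supported (gen2 a b)"
    define \<tau> where "\<tau> n = (SOME p. p \<in> S n)" for n
    \<comment> \<open>An exponent may have several representations a*i + b*j. The whole coefficient
      goes to the chosen one, \<open>\<tau> n\<close>, so that the sum over all of them returns it
      once.\<close>
    define c where "c i j = (if \<tau> (a * i + b * j) = (i, j) then f $ (a * i + b * j) else 0)" for i j
    have "(\<Sum>(i, j)\<in>S n. c i j) = f $ n" for n
    proof -
      have "(\<Sum>(i, j)\<in>S n. c i j) = (\<Sum>p\<in>S n. if p = \<tau> n then f $ n else 0)"
      proof (rule sum.cong)
        fix p assume "p \<in> S n"
        then obtain i j where "p = (i, j)" "a * i + b * j = n" unfolding S_def by blast
        then show "(case p of (i, j) \<Rightarrow> c i j) = (if p = \<tau> n then f $ n else 0)"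
          unfolding c_def by (simp add: eq_commute[of "\<tau> n"])
      qed simp
      also have "\<dots> = (if \<tau> n \<in> S n then f $ n else 0)" using S by simp
      also have "\<dots> = f $ n"
      proof (cases "f $ n = 0")
        case False
        then have "n \<in> gen2 a b" by (rule supportedD[OF f])
        then have "\<exists>p. p \<in> S n" unfolding S_def gen2_def by auto
        then have "\<tau> n \<in> S n" unfolding \<tau>_def by (rule someI_ex)
        then show ?thesis by simp
      qed simp
      finally show ?thesis .
    qed
    then have "f = Abs_fps (\<lambda>n. \<Sum>(i, j)\<in>S n. c i j)" by (intro fps_ext) simp
    then show "f \<in> {Abs_fps (\<lambda>n. \<Sum>(i, j)\<in>S n. c i j) | c. True}" by blast
  qed
  then show ?thesis unfolding fps_subring2_def ring_on_def S_def by simp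
qed

lemma mem_gen2_Suc: "r \<le> q \<Longrightarrow> a * q + r \<in> gen2 a (a + 1)"
proof -
  assume "r \<le> q"
  then obtain d where "q = r + d" using le_Suc_ex by blast
  then have "a * q + r = a * d + (a + 1) * r" by (simp add: algebra_simps)
  then show ?thesis unfolding gen2_def by blast
qed

text \<open>With \<open>mem_gen2_Suc\<close> this shows that the semigroup is the union of the
  blocks [a*q, a*q + q]. In a*(i + j) + j, a large j may carry over into the quotient, which only
  increases it.\<close>

lemma gen2_Suc_remainder_le:
  assumes "a * q + r \<in> gen2 a (a + 1)" "r < a" shows "r \<le> q"
proof -
  obtain i j where *: "a * q + r = a * i + (a + 1) * j" using assms(1) unfolding gen2_def by blast
  then have eq: "a * q + r = a * (i + j) + j" by (simp add: algebra_simps)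
  have "r = (a * (i + j) + j) mod a" unfolding eq[symmetric] using assms(2) by simp
  then have "r \<le> j" by simp
  have "q = (a * (i + j) + j) div a" unfolding eq[symmetric] using assms(2) by simp
  then have "i + j \<le> q" using assms(2) by (simp add: div_mult_self1)
  then show ?thesis using \<open>r \<le> j\<close> by simp
qed

lemma gen2_Suc_conductor:
  assumes "0 < a" "a * (a - 1) \<le> x" shows "x \<in> gen2 a (a + 1)"
proof -
  have "a - 1 \<le> x div a" using assms by (simp add: less_eq_div_iff_mult_less_eq mult.commute)
  moreover have "x mod a \<le> a - 1" using assms(1) by (simp add: Suc_leI less_Suc_eq_le[symmetric])
  ultimately show ?thesis using mem_gen2_Suc[of "x mod a" "x div a" a] by simp
qed

text \<open>This number is a*(a - 2) + (a - 1), with remainder one above the end of its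
  block.\<close>

lemma gen2_Suc_conductor_pred:
  assumes "2 \<le> a" shows "a * (a - 1) - 1 \<notin> gen2 a (a + 1)"
proof
  assume *: "a * (a - 1) - 1 \<in> gen2 a (a + 1)"
  obtain k where k: "a = Suc (Suc k)" using assms by (metis add_2_eq_Suc le_Suc_ex)
  have "a * (a - 1) - 1 = a * k + Suc k" unfolding k by simp
  with * have "a * k + Suc k \<in> gen2 a (a + 1)" by (simp only:)
  from gen2_Suc_remainder_le[OF this] show False using k by simp
qed

section \<open>The colon ideal as a set of power series\<close>

context
  fixes a :: nat and A :: "'k::field fps ring" and m :: "'k fps set"
  assumes a: "2 \<le> a"
  defines "A \<equiv> fps_subring2 a (a + 1)" and "m \<equiv> Idl\<^bsub>A\<^esub> {fps_X ^ a, fps_X ^ (a + 1)}"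
begin

interpretation C: unital_subring "supported (gen2 a (a + 1)) :: 'k fps set"
proof
  have "0 \<in> gen2 a (a + 1)" using mem_gen2_Suc[of 0 0 a] by simp
  then show "1 \<in> supported (gen2 a (a + 1))" using supported_X_power[of 0] by simp
  show "x * y \<in> supported (gen2 a (a + 1))"
    if "x \<in> supported (gen2 a (a + 1))" "y \<in> supported (gen2 a (a + 1))" for x y :: "'k fps"
    using that gen2_add by (rule supported_mult)
qed (simp_all add: supported_add supported_uminus)

lemma A_eq: "A = ring_on (supported (gen2 a (a + 1)))"
  unfolding A_def by (rule fps_subring2_eq) (use a in auto)

interpretation cring A unfolding A_eq by (rule C.cring)

lemma X_power_gen2: "i \<in> gen2 a (a + 1) \<Longrightarrow> fps_X ^ i \<in> carrier A"
  unfolding A_eq by (simp add: supported_X_power)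

lemma a_mem: "a \<in> gen2 a (a + 1)" "a + 1 \<in> gen2 a (a + 1)"
  using mem_gen2_Suc[of 0 1 a] mem_gen2_Suc[of 1 1 a] by simp_all

lemma gens_carrier: "{fps_X ^ a, fps_X ^ (a + 1)} \<subseteq> carrier A"
  using X_power_gen2 a_mem by blast

lemma ideal_pow_m: "ideal (ideal_pow A m n) A"
proof (induction n)
  case 0
  then show ?case by (simp add: oneideal)
next
  case (Suc n)
  then show ?case using ideal_prod_is_ideal[OF Suc genideal_ideal[OF gens_carrier]]
    by (simp add: m_def)
qed

lemma X_power_mem_pow_m: "fps_X ^ (a * i + (a + 1) * j) \<in> ideal_pow A m (i + j)"
proof -
  have gens: "fps_X ^ a \<in> m" "fps_X ^ (a + 1) \<in> m"
    using genideal_self[OF gens_carrier] unfolding m_def by blast+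
  have step: "fps_X ^ (x + y) \<in> ideal_pow A m (Suc n)" if "fps_X ^ x \<in> ideal_pow A m n" "fps_X ^ y \<in> m" for x y n
    using ideal_prod.prod[OF that, of A] unfolding A_eq by (simp add: power_add)
  have "fps_X ^ ((a + 1) * j) \<in> ideal_pow A m j"
  proof (induction j)
    case 0
    then show ?case using one_closed unfolding A_eq by simp
  next
    case (Suc j)
    then show ?case using step[OF Suc.IH gens(2)] by (simp only: mult_Suc_right add.commute)
  qed
  then show ?thesis
  proof (induction i)
    case (Suc i)
    have "a * Suc i + (a + 1) * j = a * i + (a + 1) * j + a" by simp
    then show ?case using step[OF Suc.IH[OF Suc.prems] gens(1)] by (simp only: add_Suc)
  qed simp
qed

lemma pow_m_subset: "ideal_pow A m n \<subseteq> supported {h. a * n \<le> h}"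
proof (induction n)
  case 0
  show ?case by (auto simp: supported_def)
next
  case (Suc n)
  have "ideal (supported {h \<in> gen2 a (a + 1). a \<le> h} :: 'k fps set) A"
  proof -
    have "c * x \<in> supported {h \<in> gen2 a (a + 1). a \<le> h}"
      if "x \<in> supported {h \<in> gen2 a (a + 1). a \<le> h}" "c \<in> supported (gen2 a (a + 1))" for c x :: "'k fps"
      by (rule supported_mult[OF that(2,1)]) (auto simp: gen2_add)
    then show ?thesis unfolding A_eq C.ideal_iff
      by (intro conjI ballI supported_mono supported_zero supported_add) auto
  qed
  moreover have "{fps_X ^ a, fps_X ^ (a + 1)} \<subseteq> (supported {h \<in> gen2 a (a + 1). a \<le> h} :: 'k fps set)"
    using a_mem supported_X_power[of a "{h \<in> gen2 a (a + 1). a \<le> h}"]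
      supported_X_power[of "a + 1" "{h \<in> gen2 a (a + 1). a \<le> h}"] by auto
  ultimately have m: "m \<subseteq> supported {h. a \<le> h}"
    unfolding m_def using genideal_minimal supported_mono[of "{h \<in> gen2 a (a + 1). a \<le> h}" "{h. a \<le> h}"] by blast
  show ?case
  proof
    fix f assume "f \<in> ideal_pow A m (Suc n)"
    then have "f \<in> ideal_prod A (ideal_pow A m n) m" by simp
    then show "f \<in> supported {h. a * Suc n \<le> h}"
    proof (induction rule: ideal_prod.induct)
      case (prod i j)
      have "i * j \<in> supported {h. a * Suc n \<le> h}"
        by (rule supported_mult[OF subsetD[OF Suc prod(1)] subsetD[OF m prod(2)]]) simp
      then show ?case unfolding A_eq by simp
    next
      case (sum s1 s2)
      then show ?case unfolding A_eq by (simp add: supported_add)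
    qed
  qed
qed

text \<open>
  \<open>m^(a - 1)\<close> is the conductor \<open>t^(a(a - 1)) k[[t]]\<close>, and the exponent just below it is a gap.
\<close>

lemma colon_eq:
  assumes s: "s \<in> gen2 a (a + 1)"
  shows "ideal_colon A (PIdl\<^bsub>A\<^esub> (fps_X ^ s)) (ideal_pow A m (a - 1))
       = supported {h \<in> gen2 a (a + 1). s \<le> h}" (is "?I = ?J")
proof
  define c where "c = a * (a - 1)"
  have c0: "0 < c" unfolding c_def using a by simp
  have PIdl: "PIdl\<^bsub>A\<^esub> (fps_X ^ s) = {x * fps_X ^ s | x. x \<in> supported (gen2 a (a + 1))}"
    unfolding cgenideal_def A_eq by simp
  have conductor: "fps_X ^ (c + j) \<in> ideal_pow A m (a - 1)" for j
  proof -
    \<comment> \<open>With k = j mod a, the exponent c + k is a*(a - 1 - k) + (a + 1)*k, a sum of a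
      - 1 generators; the remaining multiple of a comes from a factor in \<open>A\<close>.\<close>
    define k where "k = j mod a"
    have k: "k \<le> a - 1" unfolding k_def using a by (simp add: less_Suc_eq_le[symmetric])
    interpret P: ideal "ideal_pow A m (a - 1)" A by (rule ideal_pow_m)
    have "fps_X ^ (a * (a - 1 - k) + (a + 1) * k) \<in> ideal_pow A m (a - 1)"
      using X_power_mem_pow_m[of "a - 1 - k" k] by (simp only: le_add_diff_inverse2[OF k])
    moreover have "fps_X ^ (a * (j div a)) \<in> carrier A"
      using X_power_gen2 mem_gen2_Suc[of 0 "j div a" a] by simp
    ultimately have "fps_X ^ (a * (j div a)) \<otimes>\<^bsub>A\<^esub> fps_X ^ (a * (a - 1 - k) + (a + 1) * k) \<in> ideal_pow A m (a - 1)"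
      by (rule P.I_l_closed)
    moreover have "a * (j div a) + (a * (a - 1 - k) + (a + 1) * k) = c + j"
    proof -
      have "a * (a - 1 - k) + (a + 1) * k = a * (a - 1 - k + k) + k" by (simp add: algebra_simps)
      also have "\<dots> = c + k" unfolding c_def by (simp only: le_add_diff_inverse2[OF k])
      finally show ?thesis unfolding k_def by simp
    qed
    ultimately show ?thesis unfolding A_eq by (simp flip: power_add)
  qed
  show "?I \<subseteq> ?J"
  proof
    fix f assume f: "f \<in> ?I"
    then have fA: "f \<in> supported (gen2 a (a + 1))" unfolding ideal_colon_def A_eq by simp
    show "f \<in> ?J"
    proof (rule supportedI)
      fix n assume n: "f $ n \<noteq> 0"
      have "s \<le> n"
      proof (rule ccontr)
        assume "\<not> s \<le> n"
        \<comment> \<open>This shift moves the exponent n to s + (c - 1), so division by t^s would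
          produce the gap c - 1.\<close>
        define j where "j = s - 1 - n"
        have "fps_X ^ (c + j) * f \<in> PIdl\<^bsub>A\<^esub> (fps_X ^ s)"
          using f conductor[of j] unfolding ideal_colon_def A_eq by auto
        then obtain x where x: "x \<in> supported (gen2 a (a + 1))" "fps_X ^ (c + j) * f = x * fps_X ^ s"
          unfolding PIdl by blast
        have idx: "c + j + n = s + (c - 1)" unfolding j_def using \<open>\<not> s \<le> n\<close> c0 by simp
        have "f $ n = (fps_X ^ (c + j) * f) $ (c + j + n)" by (simp add: fps_X_power_mult_nth)
        also have "\<dots> = x $ (c - 1)" unfolding x(2) idx by (simp add: fps_X_power_mult_right_nth)
        finally have "c - 1 \<in> gen2 a (a + 1)" using n supportedD[OF x(1), of "c - 1"] by simp
        then show False using gen2_Suc_conductor_pred[OF a] unfolding c_def by simp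
      qed
      then show "n \<in> {h \<in> gen2 a (a + 1). s \<le> h}" using supportedD[OF fA n] by simp
    qed
  qed
  show "?J \<subseteq> ?I"
  proof
    fix f :: "'k fps" assume f: "f \<in> ?J"
    have fA: "f \<in> carrier A" unfolding A_eq
      using f supported_mono[of "{h \<in> gen2 a (a + 1). s \<le> h}" "gen2 a (a + 1)"] by auto
    have "y * f \<in> PIdl\<^bsub>A\<^esub> (fps_X ^ s)" if "y \<in> ideal_pow A m (a - 1)" for y
    proof -
      have "y \<in> supported {h. c \<le> h}" using pow_m_subset[of "a - 1"] that unfolding c_def by blast
      then have yf: "y * f \<in> supported {h. c + s \<le> h}" by (rule supported_mult[OF _ f]) simp
      \<comment> \<open>Division by t^s leaves order at least c, where every exponent belongs to the
        semigroup.\<close>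
      define x where "x = Abs_fps (\<lambda>n. (y * f) $ (n + s))"
      have "y * f = x * fps_X ^ s"
      proof (rule fps_ext)
        fix n
        show "(y * f) $ n = (x * fps_X ^ s) $ n"
          using yf unfolding supported_iff by (simp add: fps_X_power_mult_right_nth x_def)
      qed
      moreover have "x \<in> supported (gen2 a (a + 1))"
      proof (rule supportedI)
        fix n assume "x $ n \<noteq> 0"
        then have "c \<le> n" using supportedD[OF yf, of "n + s"] by (simp add: x_def)
        then show "n \<in> gen2 a (a + 1)" unfolding c_def using a by (intro gen2_Suc_conductor) auto
      qed
      ultimately show ?thesis unfolding PIdl by blast
    qed
    then show "f \<in> ?I" unfolding ideal_colon_def using fA by (simp add: A_eq)
  qed
qed

end

section \<open>Sumset arithmetic for \<open>s\<close> in the middle block\<close>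

lemma gen2_Suc_gap:
  assumes "x \<in> gen2 a (a + 1)" "a * q \<le> x" "0 < a"
  shows "x \<le> a * q + q \<or> a * (q + 1) \<le> x"
proof (cases "a * (q + 1) \<le> x")
  case False
  then have "x = a * q + (x - a * q)" "x - a * q < a" using assms(2) by auto
  then show ?thesis using gen2_Suc_remainder_le[of a q "x - a * q"] assms(1) by simp
qed simp

text \<open>Since a - 1 = 2*l, the block [a*l, a*l + l] containing \<open>s\<close> begins at
  exactly half the conductor a * (a - 1).\<close>

locale midpoint_ideal =
  fixes a l r s :: nat
  assumes l: "2 \<le> l" and a: "a = 2 * l + 1" and r: "r \<le> l" and s: "s = a * l + r"
begin

sublocale numerical_semigroup_ideal "gen2 a (a + 1)" s "a * (a - 1)"
proof
  show "0 \<in> gen2 a (a + 1)" using mem_gen2_Suc[of 0 0 a] by simp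
  show "s \<in> gen2 a (a + 1)" unfolding s by (rule mem_gen2_Suc[OF r])
  show "0 < s" unfolding s using a l by simp
  show "x \<in> gen2 a (a + 1)" if "a * (a - 1) \<le> x" for x
    using that a by (intro gen2_Suc_conductor) auto
qed (rule gen2_add)

lemma a_pos: "0 < a"
  using a by simp

lemma E_2I: "\<lbrakk>x \<in> gen2 a (a + 1); s \<le> x; y \<in> gen2 a (a + 1); s \<le> y\<rbrakk> \<Longrightarrow> x + y \<in> E 2"
  using E_SucI[of x 1 y] unfolding E_1 by (simp add: numeral_2_eq_2 del: E.simps)

text \<open>After \<open>s\<close> the next possible element is s + r + 1: trivially for r = 0, and
  as the start a*(l + 1) of the next block for r = l. Any summand other than \<open>s\<close>
  therefore contributes an excess of at least r + 1.\<close>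

lemma mem_E_cases:
  assumes "r = 0 \<or> r = l" "x \<in> E (Suc k)"
  shows "x = Suc k * s \<or> Suc k * s + r + 1 \<le> x"
proof -
  have base: "h = s \<or> s + r + 1 \<le> h" if "h \<in> gen2 a (a + 1)" "s \<le> h" for h
    using assms(1) gen2_Suc_gap[OF that(1), of l] that(2) a unfolding s by (auto simp: algebra_simps)
  show ?thesis using assms(2)
  proof (induction k arbitrary: x)
    case 0
    then show ?case using base E_1 by simp
  next
    case (Suc k)
    then obtain x' h where "x = x' + h" "x' \<in> E (Suc k)" "h \<in> gen2 a (a + 1)" "s \<le> h"
      unfolding E.simps(2)[of "Suc k"] by blast
    then show ?case using Suc.IH[of x'] base[of h] by auto
  qed
qed

text \<open>The converse of \<open>mem_E_cases\<close> for double sums. The remainder modulo a is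
  distributed over two blocks whose lengths together cover a full period.\<close>

lemma mem_E_2I:
  assumes "r = 0 \<or> r = l" "r + 1 \<le> d"
  shows "2 * s + d \<in> E 2"
proof (cases "r = 0")
  case True
  define q \<rho> where "q = d div a" and "\<rho> = d mod a"
  have d: "d = a * q + \<rho>" "\<rho> < a" unfolding q_def \<rho>_def using a_pos by simp_all
  show ?thesis
  proof (cases "\<rho> \<le> l")
    case True
    have "(a * l + \<rho>) + (a * (l + q) + 0) \<in> E 2"
      by (intro E_2I mem_gen2_Suc) (use True \<open>r = 0\<close> in \<open>auto simp: s\<close>)
    moreover have "(a * l + \<rho>) + (a * (l + q) + 0) = 2 * s + d"
      using d \<open>r = 0\<close> by (simp add: s algebra_simps)
    ultimately show ?thesis by (simp only:)
  next
    case False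
    have "(a * l + l) + (a * (l + q) + (\<rho> - l)) \<in> E 2"
    proof (intro E_2I mem_gen2_Suc)
      show "\<rho> - l \<le> l + q" using d(2) a by simp
    qed (use \<open>r = 0\<close> in \<open>auto simp: s distrib_left\<close>)
    moreover have "(a * l + l) + (a * (l + q) + (\<rho> - l)) = 2 * s + d"
      using False d \<open>r = 0\<close> by (simp add: s algebra_simps)
    ultimately show ?thesis by (simp only:)
  qed
next
  case False
  then have rl: "r = l" using assms(1) by simp
  have la: "l \<le> a" using a by simp
  \<comment> \<open>The offset l + 1 is the distance between the end of block l and the start of
    block l + 1, so d = l + 1 corresponds to the sum of these two numbers.\<close>
  define q \<rho> where "q = (d - (l + 1)) div a" and "\<rho> = (d - (l + 1)) mod a"
  have "d - (l + 1) = a * q + \<rho>" "\<rho> < a" unfolding q_def \<rho>_def using a_pos by simp_all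
  then have d: "d = a * q + \<rho> + (l + 1)" "\<rho> < a" using assms(2) rl by auto
  show ?thesis
  proof (cases "\<rho> \<le> l + 1 + q")
    case True
    have "(a * l + l) + (a * (l + 1 + q) + \<rho>) \<in> E 2"
      by (intro E_2I mem_gen2_Suc) (use True rl la in \<open>auto simp: s distrib_left\<close>)
    moreover have "(a * l + l) + (a * (l + 1 + q) + \<rho>) = 2 * s + d"
      using d rl a by (simp add: s algebra_simps)
    ultimately show ?thesis by (simp only:)
  next
    case False
    \<comment> \<open>When \<open>\<rho>\<close> overruns the second block, replacing a*l + l by
      a*(l + 1) adds l + 1, which is taken off the remainder of the other summand.\<close>
    have "(a * (l + 1) + 0) + (a * (l + 1 + q) + (\<rho> - (l + 1))) \<in> E 2"
    proof (intro E_2I mem_gen2_Suc)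
      show "\<rho> - (l + 1) \<le> l + 1 + q" using d(2) a by simp
    qed (use rl la in \<open>auto simp: s distrib_left\<close>)
    moreover have "(a * (l + 1) + 0) + (a * (l + 1 + q) + (\<rho> - (l + 1))) = 2 * s + d"
      using False d rl a by (simp add: s algebra_simps)
    ultimately show ?thesis by (simp only:)
  qed
qed

lemma Cohen_Macaulay_endpoints:
  assumes r': "r = 0 \<or> r = l"
  shows "Cohen_Macaulay (G :: (nat \<Rightarrow> 'k::field fps set) ring)"
proof (rule Cohen_Macaulay_G)
  have large: "(n + 2) * s + d \<in> E (n + 2)" if "r + 1 \<le> d" for n d
    using E_add[OF mult_s_mem_E[of n] mem_E_2I[OF r' that]] by (simp only: distrib_right add.assoc)
  fix n e assume e: "e \<in> E n" "e + s \<in> E (Suc (Suc n))"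
  show "e \<in> E (Suc n)"
  proof (cases n)
    \<comment> \<open>Degree 1 is separate because \<open>E 1\<close> can have further gaps; there
      the lower bound on e + s already gives s <= e.\<close>
    case 0
    have "e \<in> gen2 a (a + 1)" using e(1) E_subset_H by blast
    moreover have "s \<le> e" using E_lower[OF e(2)] 0 by simp
    ultimately show ?thesis using E_1 0 by simp
  next
    case (Suc k)
    from mem_E_cases[OF r' e(2)] show ?thesis
    proof
      assume "e + s = Suc (Suc n) * s"
      then show ?thesis using mult_s_mem_E[of "Suc n"] by simp
    next
      assume "Suc (Suc n) * s + r + 1 \<le> e + s"
      then have "r + 1 \<le> e - (k + 2) * s" "(k + 2) * s \<le> e" using Suc by auto
      then show ?thesis using large[of "e - (k + 2) * s" k] Suc by simp
    qed
  qed
qed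

text \<open>The exponent a*(2*l + 1) equals 2*s + 2*(l - r) + 1. It escapes double sums because r >
  0, while r < l puts s + 1 into the semigroup and fills the high powers.\<close>

lemma not_Cohen_Macaulay_between:
  assumes "0 < r" "r < l"
  shows "\<not> Cohen_Macaulay (G :: (nat \<Rightarrow> 'k::field fps set) ring)"
proof (rule not_Cohen_Macaulay_G_if_delayed_filling)
  show "a * (a - 1) \<le> 2 * s" unfolding s a by (simp add: algebra_simps)
  show "2 * s \<le> a * (2 * l + 1)" unfolding s using a r by (simp add: algebra_simps)
  show "a * (2 * l + 1) \<notin> E 2"
  proof
    assume "a * (2 * l + 1) \<in> E 2"
    then have "a * (2 * l + 1) \<in> E (Suc 1)" by (simp add: numeral_2_eq_2)
    then obtain x y where xy: "a * (2 * l + 1) = x + y" "x \<in> E 1" "y \<in> E 1"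
      unfolding E.simps(2)[of 1] E_1 by blast
    \<comment> \<open>Two summands in the block of \<open>s\<close> reach at most a*(2*l + 1) - 1; a
      summand from a later block gives at least a*(l + 1) + s = a*(2*l + 1) + r.\<close>
    have "x \<le> a * l + l \<or> a * (l + 1) \<le> x" "y \<le> a * l + l \<or> a * (l + 1) \<le> y" "s \<le> x" "s \<le> y"
      using gen2_Suc_gap[of _ a l] xy(2,3) a unfolding E_1 by (auto simp: s)
    then show False using xy(1) assms unfolding s a by (auto simp: algebra_simps)
  qed
  show "2 \<le> a * (a - 1)" using a l by (simp add: algebra_simps)
  have s1: "s + 1 \<in> gen2 a (a + 1)"
    using mem_gen2_Suc[of "r + 1" l a] assms by (simp add: s)
  have small: "k * s + j \<in> E k" if "j \<le> k" for k j
    using that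
  proof (induction k arbitrary: j)
    case 0
    then show ?case using mult_s_mem_E[of 0] by simp
  next
    case (Suc k)
    show ?case
    proof (cases j)
      case 0
      then show ?thesis using mult_s_mem_E[of "Suc k"] by simp
    next
      case (Suc j')
      then have "(k * s + j') + (s + 1) \<in> E (Suc k)"
        using Suc.IH[of j'] Suc.prems s1 by (intro E_SucI) auto
      then show ?thesis using Suc by (simp add: algebra_simps del: E.simps)
    qed
  qed
  \<comment> \<open>With as many summands as the conductor, sums of \<open>s\<close> and s + 1 fill
    the whole interval up to the point where \<open>E_upper\<close> takes over.\<close>
  show "x \<in> E (a * (a - 1))" if "a * (a - 1) * s \<le> x" for x
  proof (cases "x - a * (a - 1) * s \<le> a * (a - 1)")
    case True
    then show ?thesis using small[OF True] that by simp
  next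
    case False
    then show ?thesis by (intro E_upper) simp
  qed
qed

end

theorem corollary3p10:
  fixes a l r s :: nat
    and A :: "'k::field fps ring"
    and m I :: "'k fps set"
  assumes "a \<ge> 5" and "l \<ge> 2" and "a = 2 * l + 1"
    and "A = fps_subring2 a (a + 1)"
    and "m = Idl\<^bsub>A\<^esub> {fps_X ^ a, fps_X ^ (a + 1)}"
    and "r \<le> l" and "s = a * l + r"
    and "I = ideal_colon A (PIdl\<^bsub>A\<^esub> (fps_X ^ s)) (ideal_pow A m (a - 1))"
  shows "Cohen_Macaulay (assoc_graded A I) \<longleftrightarrow> r = 0 \<or> r = l"
proof -
  interpret N: midpoint_ideal a l r s by unfold_locales fact+
  have a2: "2 \<le> a" using assms(1) by simp
  have A: "A = N.A" unfolding assms(4) N.A_def by (rule fps_subring2_eq) (use a2 in auto)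
  have "I = supported {h \<in> gen2 a (a + 1). s \<le> h}"
    unfolding assms(8,5,4) by (rule colon_eq[OF a2 N.s_mem])
  then have I: "I = N.I" unfolding N.I_def N.E_1 .
  have "Cohen_Macaulay (N.G :: (nat \<Rightarrow> 'k fps set) ring) \<longleftrightarrow> r = 0 \<or> r = l"
    using N.Cohen_Macaulay_endpoints N.not_Cohen_Macaulay_between \<open>r \<le> l\<close>
    by (metis gr_zeroI le_neq_implies_less)
  then show ?thesis unfolding A I N.G_def .
qed

end
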